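(* Let $\mathcal{A}$ be a central, essential arrangement of hyperplanes in $\mathbb{C}^n$, let $U(\mathcal{A})\subset\mathbb{P}^{n-1}$ be its projectivized complement, let $\mathcal{G}$ be a building set for $\mathcal{A}$, and let $S\in\mathcal{N}(\mathcal{G})$ be a nested set. Then the group $\bar{C}_S:=\langle\bar\gamma_X : X\in S\rangle$ is a free abelian subgroup of $\bar G=\pi_1(U(\mathcal{A}))$ of rank $k:=|S|$.
   Context: Central means all hyperplanes contain $0$; essential means their intersection is $\{0\}$. $M(\mathcal{A})=\mathbb{C}^n\setminus\bigcup_{H\in\mathcal{A}}H$ and $U(\mathcal{A})=M(\mathcal{A})/\mathbb{C}^*$. $L(\mathcal{A})$ is the lattice of all intersections of hyperplanes (flats), ordered by reverse inclusion, ranked by codimension, with minimum $\hat0=\mathbb{C}^n$, maximum $\hat1=\{0\}$, and join given by intersection; $L_{\ge1}(\mathcal{A})=L(\mathcal{A})\setminus\{\hat0\}$. For a flat $X$, $\mathcal{A}_X=\{H\in\mathcal{A}: H\le X\}$. A building set (De Concini–Procesi) is a subset $\mathcal{G}\subseteq L_{\ge1}(\mathcal{A})$ such that for every $X\in L_{\ge1}(\mathcal{A})$, if $G_1,\dots,G_m$ are the maximal elements of $\{G\in\mathcal{G}: G\le X\}$, then the join map $\prod_i[\hat0,G_i]\to[\hat0,X]$ is an isomorphism of posets; we assume $\hat1\in\mathcal{G}$. A subset $S\subseteq\mathcal{G}$ is nested if the join of any two or more pairwise incomparable elements of $S$ does not lie in $\mathcal{G}$. $\mathcal{N}(\mathcal{G})$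 is the simplicial complex of nested sets contained in $\mathcal{G}\setminus\{\hat1\}$ (including $\emptyset$). Construction of $\bar\gamma_X$. Fix a basepoint $x_V\in M(\mathcal{A})$ sufficiently close to $0$. For a flat $X$ choose $x_X$ in the relative interior of $X$ (in $X$ but in no hyperplane not containing $X$) such that the real interval $[x_V,x_X]$ meets only hyperplanes of $\mathcal{A}_X$. Let $B_X$ be the Minkowski sum of $[x_V,x_X]$ with a closed ball of radius $\epsilon$ so small that $B_X\cap H\neq\emptyset$ iff $H\le X$. Let $r_X\colon M(\mathcal{A}_X)\to M(\mathcal{A})$ be the basepoint-preserving map which is the identity on $B_X\cap M(\mathcal{A}_X)$ and radial projection (toward $x_X$) to $\partial B_X$ elsewhere. Let $\gamma_0^X\in\pi_1(M(\mathcal{A}_X),x_V)$ be the class of the loop $t\mapsto e^{2\pi i t}x_V$, put $\gamma_X=(r_X)_\sharp(\gamma_0^X)\in\pi_1(M(\mathcal{A}),x_V)$, and let $\bar\gamma_X\in\pi_1(U(\mathcal{A}),\bar x_V)$ be its image under the Hopf projection $M(\mathcal{A})\to U(\mathcal{A})$.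
   Formalization: The points x_X are chosen depending on the building set and the nested set S: suitable admissible x_X exist for each S, and the claim holds for all admissible radii ε. For arbitrary admissible points the classes of a nested set need not commute. *)

theory Defs
  imports "HOL-Analysis.Analysis" "HOL-Algebra.Free_Abelian_Groups"
begin

section \<open>The fundamental group\<close>

text \<open>
  The library has homotopies relative to a property, for maps between abstract topologies, but no
  fundamental group. Abstract topologies are used because the projectivized complement below is a
  quotient space. Only the values of a loop on the interval from 0 to 1 matter; functions
  that agree there are homotopic and hence have the same class.
\<close>

definition loopin :: "'a topology \<Rightarrow> 'a \<Rightarrow> (real \<Rightarrow> 'a) \<Rightarrow> bool" where
  "loopin X a g \<longleftrightarrow> pathin X g \<and> g 0 = a \<and> g 1 = a"

definition loop_homotopic :: "'a topology \<Rightarrow> 'a \<Rightarrow> (real \<Rightarrow> 'a) \<Rightarrow> (real \<Rightarrow> 'a) \<Rightarrow> bool" where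
  "loop_homotopic X a g h \<longleftrightarrow>
     homotopic_with (\<lambda>f. f 0 = a \<and> f 1 = a) (top_of_set {0..1}) X g h"

definition loop_class :: "'a topology \<Rightarrow> 'a \<Rightarrow> (real \<Rightarrow> 'a) \<Rightarrow> (real \<Rightarrow> 'a) set" where
  "loop_class X a g = {h. loop_homotopic X a g h}"

text \<open>The operation \<open>+++\<close> of the library is restricted to types of class topological space,
  which set types are not.\<close>

definition concat_loops :: "(real \<Rightarrow> 'a) \<Rightarrow> (real \<Rightarrow> 'a) \<Rightarrow> real \<Rightarrow> 'a" where
  "concat_loops f g = (\<lambda>t. if t \<le> 1/2 then f (2 * t) else g (2 * t - 1))"

definition fundamental_group :: "'a topology \<Rightarrow> 'a \<Rightarrow> (real \<Rightarrow> 'a) set monoid" where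
  "fundamental_group X a =
     \<lparr>carrier = loop_class X a ` {g. loopin X a g},
      monoid.mult = (\<lambda>P Q. \<Union>f\<in>P. \<Union>g\<in>Q. loop_class X a (concat_loops f g)),
      one = loop_class X a (\<lambda>t. a)\<rparr>"

text \<open>The map induced by \<open>f\<close> on classes of loops; \<open>Y\<close> is the target and \<open>b\<close> its basepoint.\<close>

definition induced_map ::
  "'b topology \<Rightarrow> 'b \<Rightarrow> ('a \<Rightarrow> 'b) \<Rightarrow> (real \<Rightarrow> 'a) set \<Rightarrow> (real \<Rightarrow> 'b) set" where
  "induced_map Y b f P = (\<Union>g\<in>P. loop_class Y b (f \<circ> g))"


section \<open>Hyperplane arrangements\<close>

definition complex_hyperplane :: "(complex^'n) set \<Rightarrow> bool" where
  "complex_hyperplane H \<longleftrightarrow> (\<exists>a b. a \<noteq> 0 \<and> H = {x. (\<Sum>i\<in>UNIV. a $ i * x $ i) = b})"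

definition arrangement :: "(complex^'n) set set \<Rightarrow> bool" where
  "arrangement A \<longleftrightarrow> finite A \<and> (\<forall>H\<in>A. complex_hyperplane H)"

definition central :: "(complex^'n) set set \<Rightarrow> bool" where
  "central A \<longleftrightarrow> (\<forall>H\<in>A. 0 \<in> H)"

definition essential :: "(complex^'n) set set \<Rightarrow> bool" where
  "essential A \<longleftrightarrow> \<Inter>A = {0}"

definition complement :: "(complex^'n) set set \<Rightarrow> (complex^'n) set" where
  "complement A = UNIV - \<Union>A"

definition complement_top :: "(complex^'n) set set \<Rightarrow> (complex^'n) topology" where
  "complement_top A = top_of_set (complement A)"

text \<open>The Hopf projection, sending a point to its orbit under the nonzero scalars.\<close>

definition hopf :: "complex^'n \<Rightarrow> (complex^'n) set" where
  "hopf x = {c *s x | c. c \<noteq> 0}"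

text \<open>The projectivized complement, with the quotient topology.\<close>

definition proj_complement_top :: "(complex^'n) set set \<Rightarrow> (complex^'n) set topology" where
  "proj_complement_top A =
     topology (\<lambda>W. W \<subseteq> hopf ` complement A \<and>
                   openin (complement_top A) {x \<in> complement A. hopf x \<in> W})"

lemma openin_proj_complement_top:
  "openin (proj_complement_top A) W \<longleftrightarrow>
     W \<subseteq> hopf ` complement A \<and> openin (complement_top A) {x \<in> complement A. hopf x \<in> W}"
proof -
  let ?P = "\<lambda>W. W \<subseteq> hopf ` complement A \<and>
              openin (complement_top A) {x \<in> complement A. hopf x \<in> W}"
  have "?P (S \<inter> T)" if "?P S" "?P T" for S T
  proof -
    have "{x \<in> complement A. hopf x \<in> S \<inter> T}
        = {x \<in> complement A. hopf x \<in> S} \<inter> {x \<in> complement A. hopf x \<in> T}" by auto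
    then show ?thesis using that by auto
  qed
  moreover have "?P (\<Union>K)" if "\<forall>W\<in>K. ?P W" for K
  proof -
    have "{x \<in> complement A. hopf x \<in> \<Union>K} = (\<Union>W\<in>K. {x \<in> complement A. hopf x \<in> W})" by auto
    moreover have "openin (complement_top A) (\<Union>W\<in>K. {x \<in> complement A. hopf x \<in> W})"
      using that by (intro openin_Union) auto
    ultimately show ?thesis using that by auto
  qed
  ultimately have "istopology ?P"
    unfolding istopology_def by blast
  then show ?thesis
    unfolding proj_complement_top_def by (simp add: topology_inverse')
qed

lemma topspace_proj_complement_top: "topspace (proj_complement_top A) = hopf ` complement A"
proof -
  have "{x \<in> complement A. hopf x \<in> hopf ` complement A} = topspace (complement_top A)"
    by (auto simp: complement_top_def)
  then have "openin (proj_complement_top A) (hopf ` complement A)"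
    unfolding openin_proj_complement_top by simp
  then show ?thesis
    using openin_proj_complement_top openin_subset by (metis openin_topspace subset_antisym)
qed

lemma quotient_map_hopf: "quotient_map (complement_top A) (proj_complement_top A) hopf"
  unfolding quotient_map_def
  by (auto simp: topspace_proj_complement_top openin_proj_complement_top complement_top_def)


section \<open>The intersection lattice, building sets and nested sets\<close>

text \<open>The empty intersection gives the whole space, the minimum of the lattice.\<close>

definition flats :: "(complex^'n) set set \<Rightarrow> (complex^'n) set set" where
  "flats A = {\<Inter>B | B. B \<subseteq> A}"

abbreviation flat_le :: "(complex^'n) set \<Rightarrow> (complex^'n) set \<Rightarrow> bool" where
  "flat_le X Y \<equiv> Y \<subseteq> X"

definition lower_interval :: "(complex^'n) set set \<Rightarrow> (complex^'n) set \<Rightarrow> (complex^'n) set set" where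
  "lower_interval A X = {Y \<in> flats A. flat_le Y X}"

definition localization :: "(complex^'n) set set \<Rightarrow> (complex^'n) set \<Rightarrow> (complex^'n) set set" where
  "localization A X = {H \<in> A. flat_le H X}"

definition poset_iso ::
  "'a set \<Rightarrow> ('a \<Rightarrow> 'a \<Rightarrow> bool) \<Rightarrow> 'b set \<Rightarrow> ('b \<Rightarrow> 'b \<Rightarrow> bool) \<Rightarrow> ('a \<Rightarrow> 'b) \<Rightarrow> bool" where
  "poset_iso P leP Q leQ f \<longleftrightarrow>
     bij_betw f P Q \<and> (\<forall>x\<in>P. \<forall>y\<in>P. leP x y \<longleftrightarrow> leQ (f x) (f y))"

text \<open>The maximal elements of the set of members of \<open>G\<close> that are below \<open>X\<close>.\<close>

definition building_factors ::
  "(complex^'n) set set \<Rightarrow> (complex^'n) set \<Rightarrow> (complex^'n) set set" where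
  "building_factors G X =
     {Y \<in> G. flat_le Y X \<and> (\<forall>Z\<in>G. flat_le Z X \<longrightarrow> flat_le Y Z \<longrightarrow> Z = Y)}"

definition building_set :: "(complex^'n) set set \<Rightarrow> (complex^'n) set set \<Rightarrow> bool" where
  "building_set A G \<longleftrightarrow>
     G \<subseteq> flats A - {UNIV} \<and> {0} \<in> G \<and>
     (\<forall>X \<in> flats A - {UNIV}.
        poset_iso
          (\<Pi>\<^sub>E Y \<in> building_factors G X. lower_interval A Y)
          (\<lambda>f g. \<forall>Y \<in> building_factors G X. flat_le (f Y) (g Y))
          (lower_interval A X) flat_le
          (\<lambda>f. \<Inter>Y \<in> building_factors G X. f Y))"

definition nested :: "(complex^'n) set set \<Rightarrow> (complex^'n) set set \<Rightarrow> bool" where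
  "nested G S \<longleftrightarrow> S \<subseteq> G \<and>
     (\<forall>T \<subseteq> S. 2 \<le> card T \<and>
        (\<forall>X\<in>T. \<forall>Y\<in>T. X \<noteq> Y \<longrightarrow> \<not> flat_le X Y \<and> \<not> flat_le Y X) \<longrightarrow> \<Inter>T \<notin> G)"

definition nested_complex :: "(complex^'n) set set \<Rightarrow> (complex^'n) set set set" where
  "nested_complex G = {S. nested G S \<and> S \<subseteq> G - {{0}}}"


section \<open>The loops attached to flats\<close>

text \<open>In the following, \<open>v\<close> is the basepoint in the complement, \<open>p\<close> the point chosen in the
  flat \<open>X\<close>, and \<open>e\<close> the radius of the tube around the segment from \<open>v\<close> to \<open>p\<close>.

  The class of the loop below does not depend on \<open>e\<close>, but it does depend on \<open>p\<close>: two admissible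
  points in \<open>X\<close> can give conjugate, distinct classes. Independent choices for two flats of a nested
  set can give classes that do not commute, so the points have to be chosen compatibly for the
  nested set under consideration.\<close>

definition admissible_point ::
  "(complex^'n) set set \<Rightarrow> complex^'n \<Rightarrow> (complex^'n) set \<Rightarrow> complex^'n \<Rightarrow> bool" where
  "admissible_point A v X p \<longleftrightarrow>
     p \<in> X \<and> (\<forall>H\<in>A. \<not> X \<subseteq> H \<longrightarrow> p \<notin> H) \<and>
     (\<forall>H\<in>A. closed_segment v p \<inter> H \<noteq> {} \<longrightarrow> H \<in> localization A X)"

definition tube :: "complex^'n \<Rightarrow> complex^'n \<Rightarrow> real \<Rightarrow> (complex^'n) set" where
  "tube v p e = {x + y | x y. x \<in> closed_segment v p \<and> y \<in> cball 0 e}"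

definition admissible_radius ::
  "(complex^'n) set set \<Rightarrow> complex^'n \<Rightarrow> (complex^'n) set \<Rightarrow> complex^'n \<Rightarrow> real \<Rightarrow> bool" where
  "admissible_radius A v X p e \<longleftrightarrow>
     e > 0 \<and> (\<forall>H\<in>A. tube v p e \<inter> H \<noteq> {} \<longleftrightarrow> flat_le H X)"

text \<open>Outside the tube \<open>x\<close> is sent to the only point of the segment from \<open>p\<close> to \<open>x\<close> lying on the
  boundary of the tube, which is convex and has \<open>p\<close> in its interior.\<close>

definition tube_retraction :: "complex^'n \<Rightarrow> complex^'n \<Rightarrow> real \<Rightarrow> complex^'n \<Rightarrow> complex^'n" where
  "tube_retraction v p e x =
     (if x \<in> tube v p e then x
      else (THE y. y \<in> closed_segment p x \<inter> frontier (tube v p e)))"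

definition gamma0 :: "(complex^'n) set set \<Rightarrow> complex^'n \<Rightarrow> (complex^'n) set \<Rightarrow>
    (real \<Rightarrow> complex^'n) set" where
  "gamma0 A v X =
     loop_class (complement_top (localization A X)) v
       (\<lambda>t. exp (2 * of_real pi * \<i> * of_real t) *s v)"

definition gamma :: "(complex^'n) set set \<Rightarrow> complex^'n \<Rightarrow> (complex^'n) set \<Rightarrow> complex^'n \<Rightarrow> real \<Rightarrow>
    (real \<Rightarrow> complex^'n) set" where
  "gamma A v X p e = induced_map (complement_top A) v (tube_retraction v p e) (gamma0 A v X)"

definition gamma_bar :: "(complex^'n) set set \<Rightarrow> complex^'n \<Rightarrow> (complex^'n) set \<Rightarrow> complex^'n \<Rightarrow> real \<Rightarrow>
    (real \<Rightarrow> (complex^'n) set) set" where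
  "gamma_bar A v X p e = induced_map (proj_complement_top A) (hopf v) hopf (gamma A v X p e)"


section \<open>Free abelian subgroups\<close>

definition free_abelian_subgroup :: "'a set \<Rightarrow> 'a monoid \<Rightarrow> nat \<Rightarrow> bool" where
  "free_abelian_subgroup C G k \<longleftrightarrow>
     subgroup C G \<and> G\<lparr>carrier := C\<rparr> \<cong> free_Abelian_group {..<k}"

end

theory Submission
  imports Defs "HOL-Complex_Analysis.Complex_Analysis"
begin

text \<open>
  The loop around a flat \<open>X\<close> is made explicit first. In the complement of the
  localization at \<open>X\<close>, rotating \<open>v\<close> around 0 is homotopic to rotating it
  around the chosen point \<open>p\<close> of \<open>X\<close>, and within that homotopy class the
  loop can be shrunk to a keyhole: go along the segment from \<open>v\<close> towards
  \<open>p\<close>, turn once around \<open>p\<close> in the complex line through both, and return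
  (\<open>gamma_eq_keyhole\<close>). The keyhole lies in the tube, where the retraction does
  nothing.

  Two such loops commute if they extend to a torus in the complement. With \<open>w X = v - p
  X\<close>, the torus for incomparable \<open>X\<close> and \<open>Y\<close> is the sum of both
  displacements of \<open>v\<close>; for \<open>Y \<subseteq> X\<close>, the loop around
  \<open>Y\<close> rescales the one around \<open>X\<close> in addition. Both tori avoid all
  hyperplanes if the shifts form a compatible system (\<open>compatible_shifts\<close>): \<open>w
  X\<close> lies in every flat of the nested set that is incomparable to \<open>X\<close>, and for
  every hyperplane \<open>H\<close> some real half plane separates the value of its form at
  \<open>v\<close> from the values at all \<open>w X\<close> with \<open>H\<close> not containing
  \<open>X\<close> (\<open>keyhole_loops_commute\<close>).

  That compatible systems exist is where building sets and nested sets enter. An antichain in a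
  nested set consists of the factors of its join (\<open>antichain_factors\<close>), so the
  interval below the join is a product. Therefore \<open>X\<close> and the intersection of the
  flats incomparable to it span the space (\<open>incomparable_complement\<close>), the elements
  of the nested set above a hyperplane form a chain, and below every element there is a hyperplane
  that is below no elements of the nested set except those above it
  (\<open>own_hyperplane\<close>). Adding to the shifts large multiples of generic vectors, of an
  order of magnitude that increases along the chains, makes all shifts seen by one hyperplane
  point in almost the same direction, away from the direction of \<open>v\<close>
  (\<open>compatible_shifts_exist\<close>).

  Finally, the quotient of the forms of two hyperplanes \<open>H\<close> and \<open>K\<close> is a
  nowhere vanishing function on the projectivized complement, and its winding number is additive
  on the fundamental group. If \<open>K\<close> is below no element of the nested set, the winding
  number of the loop around \<open>X\<close> is 1 or 0 according to whether \<open>H\<close>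
  contains \<open>X\<close>. By the hyperplanes just mentioned this system is triangular
  (\<open>nested_indicators_independent\<close>), so the commuting generators satisfy no further
  relation.
\<close>

section \<open>The fundamental group\<close>

text \<open>
  First coordinate: the parameter of a homotopy; second coordinate: the parameter of a loop.
\<close>
abbreviation unit_square :: "(real \<times> real) topology" where
  "unit_square \<equiv> prod_topology (top_of_set {0..1}) (top_of_set {0..1})"

lemma loop_homotopicI:
  assumes "continuous_map unit_square X h"
    and "\<And>t. t \<in> {0..1} \<Longrightarrow> h (0, t) = f t" "\<And>t. t \<in> {0..1} \<Longrightarrow> h (1, t) = g t"
    and "\<And>s. s \<in> {0..1} \<Longrightarrow> h (s, 0) = a" "\<And>s. s \<in> {0..1} \<Longrightarrow> h (s, 1) = a"
  shows "loop_homotopic X a f g"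
  unfolding loop_homotopic_def
proof (subst homotopic_with)
  show "\<exists>h. continuous_map unit_square X h \<and> (\<forall>x\<in>topspace (top_of_set {0..1}). h (0, x) = f x) \<and>
      (\<forall>x\<in>topspace (top_of_set {0..1}). h (1, x) = g x) \<and> (\<forall>t\<in>{0..1}. h (t, 0) = a \<and> h (t, 1) = a)"
    unfolding topspace_euclidean_subtopology using assms by blast
qed simp

lemma loop_homotopicE:
  assumes "loop_homotopic X a f g"
  obtains h where "continuous_map unit_square X h"
    "\<And>t. h (0, t) = f t" "\<And>t. h (1, t) = g t"
    "\<And>s. s \<in> {0..1} \<Longrightarrow> h (s, 0) = a" "\<And>s. s \<in> {0..1} \<Longrightarrow> h (s, 1) = a"
proof -
  obtain h where "continuous_map unit_square X h" "\<forall>t. h (0, t) = f t" "\<forall>t. h (1, t) = g t"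
    "\<forall>s\<in>{0..1}. h (s, 0) = a \<and> h (s, 1) = a"
    using assms unfolding loop_homotopic_def homotopic_with_def by (elim exE conjE) (rule that)
  then show thesis by (intro that[of h]) simp_all
qed

lemma loop_homotopic_refl: "loopin X a f \<Longrightarrow> loop_homotopic X a f f"
  by (simp add: loop_homotopic_def loopin_def pathin_def)

lemma loop_homotopic_sym: "loop_homotopic X a f g \<Longrightarrow> loop_homotopic X a g f"
  unfolding loop_homotopic_def by (rule homotopic_with_symD)

lemma loop_homotopic_trans [trans]:
  "loop_homotopic X a f g \<Longrightarrow> loop_homotopic X a g h \<Longrightarrow> loop_homotopic X a f h"
  unfolding loop_homotopic_def by (rule homotopic_with_trans)

lemma loop_homotopic_loopin:
  assumes "loop_homotopic X a f g"
  shows "loopin X a f" "loopin X a g"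
  using homotopic_with_imp_continuous_maps[OF assms[unfolded loop_homotopic_def]]
    homotopic_with_imp_property[OF assms[unfolded loop_homotopic_def]]
  by (auto simp: loopin_def pathin_def)

lemma loop_homotopic_cong:
  assumes "loopin X a f" "\<And>t. t \<in> {0..1} \<Longrightarrow> f t = g t"
  shows "loop_homotopic X a f g"
  unfolding loop_homotopic_def
  by (rule homotopic_with_equal) (use assms in \<open>auto simp: loopin_def pathin_def\<close>)

lemma loop_class_eqI: "loop_homotopic X a f g \<Longrightarrow> loop_class X a f = loop_class X a g"
  unfolding loop_class_def
  by (intro Collect_cong iffI) (erule (1) loop_homotopic_trans[OF loop_homotopic_sym], erule (1) loop_homotopic_trans)

lemma in_own_loop_class: "loopin X a f \<Longrightarrow> f \<in> loop_class X a f"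
  by (simp add: loop_class_def loop_homotopic_refl)

lemma loop_homotopic_compose:
  assumes "loop_homotopic X a f g" "continuous_map X Y k" "k a = b"
  shows "loop_homotopic Y b (k \<circ> f) (k \<circ> g)"
  using assms unfolding loop_homotopic_def
  by (auto intro: homotopic_with_compose_continuous_map_left)

lemma loopin_compose: "loopin X a f \<Longrightarrow> continuous_map X Y k \<Longrightarrow> k a = b \<Longrightarrow> loopin Y b (k \<circ> f)"
  by (auto simp: loopin_def pathin_def intro: continuous_map_compose)

lemma induced_map_loop_class:
  assumes "loopin X a f" "continuous_map X Y k" "k a = b"
  shows "induced_map Y b k (loop_class X a f) = loop_class Y b (k \<circ> f)"
proof -
  have "loop_class Y b (k \<circ> g) = loop_class Y b (k \<circ> f)" if "g \<in> loop_class X a f" for g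
    using that by (intro sym[OF loop_class_eqI] loop_homotopic_compose[OF _ assms(2,3)])
      (simp add: loop_class_def)
  then have "induced_map Y b k (loop_class X a f) = (\<Union>g\<in>loop_class X a f. loop_class Y b (k \<circ> f))"
    unfolding induced_map_def by (intro SUP_cong refl)
  with in_own_loop_class[OF assms(1)] show ?thesis by (metis UN_constant empty_iff)
qed

text \<open>
  Gluing two homotopies along \<open>1/2\<close>; the parameter space \<open>T\<close> is the time
  of the homotopy.
\<close>
lemma continuous_map_concat:
  assumes f: "continuous_map (prod_topology T (top_of_set {0..1})) X f"
    and g: "continuous_map (prod_topology T (top_of_set {0..1})) X g"
    and "\<And>s. s \<in> topspace T \<Longrightarrow> f (s, 1) = g (s, 0)"
  shows "continuous_map (prod_topology T (top_of_set {0..1::real})) X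
           (\<lambda>x. if snd x \<le> 1/2 then f (fst x, 2 * snd x) else g (fst x, 2 * snd x - 1))"
proof (rule continuous_map_cases_le)
  let ?TI = "prod_topology T (top_of_set {0..1::real})"
  have snd: "continuous_map (subtopology ?TI C) euclideanreal snd" for C
    using continuous_map_snd[of T "top_of_set {0..1::real}"]
    by (metis continuous_map_from_subtopology continuous_map_in_subtopology)
  have fst: "continuous_map (subtopology ?TI C) T fst" for C
    by (simp add: continuous_map_fst continuous_map_from_subtopology)
  show "continuous_map ?TI euclideanreal snd"
    using snd[of UNIV] by simp
  show "continuous_map (subtopology ?TI {x \<in> topspace ?TI. snd x \<le> 1/2}) X
          (\<lambda>x. f (fst x, 2 * snd x))"
    by (rule continuous_map_compose[OF _ f, unfolded o_def])
       (auto simp: continuous_map_pairwise o_def continuous_map_in_subtopology fst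
         intro!: continuous_map_real_mult snd)
  show "continuous_map (subtopology ?TI {x \<in> topspace ?TI. 1/2 \<le> snd x}) X
          (\<lambda>x. g (fst x, 2 * snd x - 1))"
    by (rule continuous_map_compose[OF _ g, unfolded o_def])
       (auto simp: continuous_map_pairwise o_def continuous_map_in_subtopology fst
         intro!: continuous_map_real_mult continuous_map_diff snd)
  fix x assume "x \<in> topspace (prod_topology T (top_of_set {0..1::real}))" "snd x = 1/2"
  then have "fst x \<in> topspace T" "2 * snd x = 1" by auto
  then show "f (fst x, 2 * snd x) = g (fst x, 2 * snd x - 1)" using assms(3) by simp
qed simp

lemma loop_homotopic_concat:
  assumes "loop_homotopic X a f f'" "loop_homotopic X a g g'"
  shows "loop_homotopic X a (concat_loops f g) (concat_loops f' g')"
proof -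
  obtain h where h: "continuous_map unit_square X h"
    "\<And>t. h (0, t) = f t" "\<And>t. h (1, t) = f' t"
    "\<And>s. s \<in> {0..1} \<Longrightarrow> h (s, 0) = a" "\<And>s. s \<in> {0..1} \<Longrightarrow> h (s, 1) = a"
    using assms(1) by (rule loop_homotopicE) blast
  obtain k where k: "continuous_map unit_square X k"
    "\<And>t. k (0, t) = g t" "\<And>t. k (1, t) = g' t"
    "\<And>s. s \<in> {0..1} \<Longrightarrow> k (s, 0) = a" "\<And>s. s \<in> {0..1} \<Longrightarrow> k (s, 1) = a"
    using assms(2) by (rule loop_homotopicE) blast
  show ?thesis
    by (rule loop_homotopicI[OF continuous_map_concat[OF h(1) k(1)]])
       (auto simp: h k concat_loops_def)
qed

lemma loopin_concat: "loopin X a f \<Longrightarrow> loopin X a g \<Longrightarrow> loopin X a (concat_loops f g)"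
  by (rule loop_homotopic_loopin(1)[OF loop_homotopic_concat[OF loop_homotopic_refl loop_homotopic_refl]])

text \<open>
  Two paths in a convex set with the same ends are joined by the straight-line homotopy, which
  \<open>c\<close> carries over to \<open>X\<close>. The group laws of the fundamental group and
  the commutation of the two factors of a torus are all instances, for intervals and for a square.
\<close>
lemma reparametrization_homotopic:
  fixes S :: "'c::real_normed_vector set"
  assumes c: "continuous_map (top_of_set S) X c" "convex S"
    and "continuous_on {0..1} p" "continuous_on {0..1} q" "p ` {0..1} \<subseteq> S" "q ` {0..1} \<subseteq> S"
    and "p 0 = q 0" "p 1 = q 1" "c (p 0) = a" "c (p 1) = a"
  shows "loop_homotopic X a (c \<circ> p) (c \<circ> q)"
proof (rule loop_homotopicI)
  let ?h = "\<lambda>x. (1 - fst x) *\<^sub>R p (snd x) + fst x *\<^sub>R q (snd x)"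
  have "continuous_on ({0..1} \<times> {0..1}) (\<lambda>x. p (snd x))"
    "continuous_on ({0..1} \<times> {0..1}) (\<lambda>x. q (snd x))"
    by (auto intro!: continuous_on_compose2[OF assms(3)] continuous_on_compose2[OF assms(4)]
          continuous_intros)
  then have "continuous_on ({0..1::real} \<times> {0..1}) ?h"
    by (intro continuous_intros)
  moreover have "?h x \<in> S" if "x \<in> {0..1} \<times> {0..1}" for x
    using that assms(2,5,6) by (intro convexD) (auto simp: image_subset_iff)
  ultimately have "continuous_map (top_of_set ({0..1} \<times> {0..1})) (top_of_set S) ?h"
    by auto
  then have "continuous_map unit_square (top_of_set S) ?h"
    by (simp only: prod_topology_subtopology_eu)
  then show "continuous_map unit_square X (c \<circ> ?h)"
    using c(1) by (rule continuous_map_compose)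
qed (use assms in \<open>simp_all add: scaleR_left_diff_distrib\<close>)

lemma loop_homotopic_reparametrize:
  assumes "loopin X a c" and "continuous_on {0..1} p" "p ` {0..1} \<subseteq> {0..1}" "p 0 = 0" "p 1 = 1"
  shows "loop_homotopic X a (c \<circ> p) c"
  using reparametrization_homotopic[of "{0..1}" X c p "\<lambda>t. t" a] assms
  by (auto simp: loopin_def pathin_def o_def)

text \<open>
  Both sides run through the same loop at different speeds; the speed change is the concave
  piecewise linear function with slopes 2, 1 and 1/2, a minimum of three linear functions.
\<close>
lemma concat_assoc:
  assumes "loopin X a f" "loopin X a g" "loopin X a h"
  shows "loop_homotopic X a (concat_loops (concat_loops f g) h) (concat_loops f (concat_loops g h))"
proof -
  let ?c = "concat_loops f (concat_loops g h)"
  let ?p = "\<lambda>t::real. min (2*t) (min (t + 1/4) ((t+1)/2))"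
  have c: "loopin X a ?c" using assms by (intro loopin_concat)
  have "continuous_on {0..1} ?p" by (auto intro!: continuous_intros)
  then have p: "loop_homotopic X a (?c \<circ> ?p) ?c"
    by (rule loop_homotopic_reparametrize[OF c]) (auto simp: min_le_iff_disj)
  have eq: "(?c \<circ> ?p) t = concat_loops (concat_loops f g) h t" if "t \<in> {0..1}" for t
  proof -
    consider "t \<le> 1/4" | "1/4 < t" "t \<le> 1/2" | "1/2 < t" by linarith
    then show ?thesis
    proof cases
      case 1 then have "?p t = 2 * t" by auto
      with 1 show ?thesis by (simp add: concat_loops_def)
    next
      case 2 then have "?p t = t + 1/4" by auto
      with 2 show ?thesis by (simp add: concat_loops_def algebra_simps)
    next
      case 3 then have "?p t = (t + 1)/2" using that by auto
      with 3 show ?thesis by (simp add: concat_loops_def field_simps)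
    qed
  qed
  have "loop_homotopic X a (?c \<circ> ?p) (concat_loops (concat_loops f g) h)"
    by (rule loop_homotopic_cong[OF loop_homotopic_loopin(1)[OF p]]) (rule eq)
  then show ?thesis by (rule loop_homotopic_trans[OF loop_homotopic_sym p])
qed

lemma concat_const_left:
  assumes "loopin X a f" shows "loop_homotopic X a (concat_loops (\<lambda>t. a) f) f"
proof -
  let ?p = "\<lambda>t::real. max 0 (2*t - 1)"
  have f: "f 0 = a" using assms by (simp add: loopin_def)
  have "continuous_on {0..1} ?p" by (auto intro!: continuous_intros)
  then have p: "loop_homotopic X a (f \<circ> ?p) f"
    by (rule loop_homotopic_reparametrize[OF assms]) auto
  have "(f \<circ> ?p) t = concat_loops (\<lambda>t. a) f t" for t
  proof (cases "t \<le> 1/2")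
    case True then have "?p t = 0" by simp
    with True f show ?thesis by (simp only: o_def concat_loops_def if_True)
  next
    case False then have "?p t = 2*t - 1" by simp
    with False show ?thesis by (simp only: o_def concat_loops_def if_False)
  qed
  then have eq: "f \<circ> ?p = concat_loops (\<lambda>t. a) f" by (rule ext)
  show ?thesis by (rule p[unfolded eq])
qed

text \<open>
  Running back and forth is \<open>f\<close> composed with a path in the interval that goes from 1
  to 0 and back to 1, and such a path contracts in the interval.
\<close>
lemma concat_reverse:
  assumes "loopin X a f" shows "loop_homotopic X a (concat_loops (f \<circ> (\<lambda>t. 1 - t)) f) (\<lambda>t. a)"
proof -
  let ?p = "\<lambda>t::real. max (1 - 2*t) (2*t - 1)"
  have f: "f 1 = a" "continuous_map (top_of_set {0..1}) X f"
    using assms by (simp_all add: loopin_def pathin_def)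
  have cp: "continuous_on {0..1} ?p" by (auto intro!: continuous_intros)
  have p: "loop_homotopic X a (f \<circ> ?p) (f \<circ> (\<lambda>t. 1))"
    by (rule reparametrization_homotopic[OF f(2) _ cp]) (use f in auto)
  have "(f \<circ> ?p) t = concat_loops (f \<circ> (\<lambda>t. 1 - t)) f t" for t
  proof (cases "t \<le> 1/2")
    case True then have "?p t = 1 - 2*t" by simp
    with True show ?thesis by (simp only: o_def concat_loops_def if_True)
  next
    case False then have "?p t = 2*t - 1" by simp
    with False show ?thesis by (simp only: o_def concat_loops_def if_False)
  qed
  then have eq: "f \<circ> ?p = concat_loops (f \<circ> (\<lambda>t. 1 - t)) f" by (rule ext)
  have const: "f \<circ> (\<lambda>t. 1) = (\<lambda>t::real. a)" using f by auto
  show ?thesis by (rule p[unfolded eq const])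
qed

lemma loopin_reverse: "loopin X a f \<Longrightarrow> loopin X a (f \<circ> (\<lambda>t. 1 - t))"
  unfolding loopin_def pathin_def
  by (intro conjI continuous_map_compose[where X' = "top_of_set {0..1}"])
     (auto intro!: continuous_intros)

lemma carrier_fundamental_group:
  "carrier (fundamental_group X a) = {loop_class X a g | g. loopin X a g}"
  by (auto simp: fundamental_group_def)

lemma mult_fundamental_group:
  assumes "loopin X a f" "loopin X a g"
  shows "loop_class X a f \<otimes>\<^bsub>fundamental_group X a\<^esub> loop_class X a g = loop_class X a (concat_loops f g)"
proof -
  have "loop_class X a (concat_loops f' g') = loop_class X a (concat_loops f g)"
    if "f' \<in> loop_class X a f" "g' \<in> loop_class X a g" for f' g'
    by (rule sym, rule loop_class_eqI, rule loop_homotopic_concat)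
       (use that in \<open>auto simp: loop_class_def\<close>)
  then have "loop_class X a f \<otimes>\<^bsub>fundamental_group X a\<^esub> loop_class X a g =
      (\<Union>f'\<in>loop_class X a f. \<Union>g'\<in>loop_class X a g. loop_class X a (concat_loops f g))"
    unfolding fundamental_group_def monoid.simps by (intro SUP_cong refl)
  with in_own_loop_class[OF assms(1)] in_own_loop_class[OF assms(2)] show ?thesis
    by (metis UN_constant empty_iff)
qed

lemma one_fundamental_group: "\<one>\<^bsub>fundamental_group X a\<^esub> = loop_class X a (\<lambda>t. a)"
  by (simp add: fundamental_group_def)

lemma loopin_const: "a \<in> topspace X \<Longrightarrow> loopin X a (\<lambda>t. a)"
  by (auto simp: loopin_def pathin_def)

lemma group_fundamental_group:
  assumes "a \<in> topspace X" shows "group (fundamental_group X a)"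
proof (rule groupI)
  let ?G = "fundamental_group X a"
  note simps = carrier_fundamental_group one_fundamental_group mult_fundamental_group
  fix x assume "x \<in> carrier ?G"
  then obtain f where f: "x = loop_class X a f" "loopin X a f"
    by (auto simp: carrier_fundamental_group)
  show "\<one>\<^bsub>?G\<^esub> \<otimes>\<^bsub>?G\<^esub> x = x"
    using f assms by (simp add: simps loopin_const loop_class_eqI[OF concat_const_left])
  have "loop_class X a (f \<circ> (\<lambda>t. 1 - t)) \<otimes>\<^bsub>?G\<^esub> x = \<one>\<^bsub>?G\<^esub>"
    using f by (simp add: simps loopin_reverse loop_class_eqI[OF concat_reverse])
  then show "\<exists>y\<in>carrier ?G. y \<otimes>\<^bsub>?G\<^esub> x = \<one>\<^bsub>?G\<^esub>"
    using loopin_reverse[OF f(2)] by (auto simp: carrier_fundamental_group)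
  fix y assume "y \<in> carrier ?G"
  then obtain g where g: "y = loop_class X a g" "loopin X a g"
    by (auto simp: carrier_fundamental_group)
  show "x \<otimes>\<^bsub>?G\<^esub> y \<in> carrier ?G"
    using f g loopin_concat[OF f(2) g(2)] by (auto simp: simps)
  fix z assume "z \<in> carrier ?G"
  then obtain h where h: "z = loop_class X a h" "loopin X a h"
    by (auto simp: carrier_fundamental_group)
  show "x \<otimes>\<^bsub>?G\<^esub> y \<otimes>\<^bsub>?G\<^esub> z = x \<otimes>\<^bsub>?G\<^esub> (y \<otimes>\<^bsub>?G\<^esub> z)"
    using f g h by (simp add: simps loopin_concat loop_class_eqI[OF concat_assoc])
qed (use loopin_const[OF assms] in \<open>auto simp: carrier_fundamental_group one_fundamental_group\<close>)

section \<open>Linear forms and flats\<close>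

definition form :: "complex^'n \<Rightarrow> complex^'n \<Rightarrow> complex" where
  "form a x = (\<Sum>i\<in>UNIV. a $ i * x $ i)"

lemma form_add: "form a (x + y) = form a x + form a y"
  and form_diff: "form a (x - y) = form a x - form a y"
  and form_scale: "form a (c *s x) = c * form a x"
  and form_zero: "form a 0 = 0"
  by (simp_all add: form_def algebra_simps sum.distrib sum_subtractf sum_distrib_left)

lemma form_sum: "form a (\<Sum>i\<in>I. f i) = (\<Sum>i\<in>I. form a (f i))"
  by (induction I rule: infinite_finite_induct) (simp_all add: form_add form_zero)

lemma continuous_on_form [continuous_intros]:
  "continuous_on S f \<Longrightarrow> continuous_on S (\<lambda>x. form a (f x))"
  unfolding form_def by (intro continuous_intros)

lemma continuous_on_smult [continuous_intros]:
  fixes f :: "'a::topological_space \<Rightarrow> complex^'n"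
  assumes "continuous_on S c" "continuous_on S f"
  shows "continuous_on S (\<lambda>x. c x *s f x)"
  unfolding vector_scalar_mult_def using assms by (intro continuous_intros)

lemma scaleR_eq_smult: "r *\<^sub>R x = of_real r *s (x :: complex^'n)"
  by (simp add: vec_eq_iff) (simp add: scaleR_conv_of_real)

lemma norm_smult: "norm (c *s x) = norm c * norm (x :: complex^'n)"
  by (simp add: norm_vec_def norm_mult L2_set_right_distrib)

locale central_arrangement =
  fixes A :: "(complex^'n) set set" and nf :: "(complex^'n) set \<Rightarrow> complex^'n"
  assumes finite_A: "finite A"
    and nf_nonzero: "H \<in> A \<Longrightarrow> nf H \<noteq> 0"
    and mem_hyperplane: "H \<in> A \<Longrightarrow> x \<in> H \<longleftrightarrow> form (nf H) x = 0"
begin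

abbreviation lin :: "(complex^'n) set \<Rightarrow> complex^'n \<Rightarrow> complex" where
  "lin H \<equiv> form (nf H)"

lemma mem_complement: "x \<in> complement A \<longleftrightarrow> (\<forall>H\<in>A. lin H x \<noteq> 0)"
  by (auto simp: complement_def mem_hyperplane)

text \<open>
  A flat is the intersection of all hyperplanes containing it, not only of those used to form it.
\<close>
lemma mem_flat:
  assumes "X \<in> flats A"
  shows "x \<in> X \<longleftrightarrow> (\<forall>H\<in>A. X \<subseteq> H \<longrightarrow> lin H x = 0)"
proof
  show "\<forall>H\<in>A. X \<subseteq> H \<longrightarrow> lin H x = 0" if "x \<in> X"
    using that by (metis mem_hyperplane subsetD)
next
  assume x: "\<forall>H\<in>A. X \<subseteq> H \<longrightarrow> lin H x = 0"
  obtain B where B: "B \<subseteq> A" "X = \<Inter>B" using assms by (auto simp: flats_def)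
  have "x \<in> H" if "H \<in> B" for H
  proof -
    have "H \<in> A" "X \<subseteq> H" using B that by auto
    then show ?thesis using x mem_hyperplane by metis
  qed
  then show "x \<in> X" using B(2) by auto
qed

lemma flat_smult: "X \<in> flats A \<Longrightarrow> x \<in> X \<Longrightarrow> c *s x \<in> X"
  and flat_add: "X \<in> flats A \<Longrightarrow> x \<in> X \<Longrightarrow> y \<in> X \<Longrightarrow> x + y \<in> X"
  and flat_diff: "X \<in> flats A \<Longrightarrow> x \<in> X \<Longrightarrow> y \<in> X \<Longrightarrow> x - y \<in> X"
  and flat_zero: "X \<in> flats A \<Longrightarrow> 0 \<in> X"
  by (simp_all add: mem_flat form_scale form_add form_diff form_zero)

lemma hyperplane_flat: "H \<in> A \<Longrightarrow> H \<in> flats A"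
  unfolding flats_def by (intro CollectI exI[of _ "{H}"]) auto

end

lemma central_arrangement_forms:
  assumes "arrangement A" "central A"
  obtains nf where "central_arrangement A nf"
proof -
  have "\<exists>a. a \<noteq> 0 \<and> H = {x. form a x = 0}" if "H \<in> A" for H
  proof -
    have "complex_hyperplane H" using assms(1) that by (simp add: arrangement_def)
    then have "\<exists>a b. a \<noteq> 0 \<and> H = {x. form a x = b}"
      unfolding complex_hyperplane_def form_def .
    then obtain a b where ab: "a \<noteq> 0" "H = {x. form a x = b}" by (elim exE conjE)
    have "0 \<in> H" using assms(2) that by (simp add: central_def)
    then have "b = 0" using ab(2) by (simp add: form_zero)
    with ab show ?thesis by (intro exI[of _ a]) simp
  qed
  then obtain nf where nf: "\<forall>H\<in>A. nf H \<noteq> 0 \<and> H = {x. form (nf H) x = 0}"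
    using bchoice[of A "\<lambda>H a. a \<noteq> 0 \<and> H = {x. form a x = 0}"] by auto
  have "central_arrangement A nf"
  proof
    show "finite A" using assms(1) by (simp add: arrangement_def)
    fix H assume H: "H \<in> A"
    show "nf H \<noteq> 0" using bspec[OF nf H] by (rule conjunct1)
    have "H = {x. form (nf H) x = 0}" using bspec[OF nf H] by (rule conjunct2)
    then show "x \<in> H \<longleftrightarrow> form (nf H) x = 0" for x by (metis mem_Collect_eq)
  qed
  then show thesis ..
qed

section \<open>The tube retraction\<close>

text \<open>
  If two points of the frontier were on one ray from the interior point \<open>p\<close>, the
  nearer one would be interior, because a convex set contains in its interior the open segment
  from \<open>p\<close> to any point of its closure.
\<close>
lemma radial_frontier_unique:
  fixes B :: "'a::euclidean_space set"
  assumes "convex B" "p \<in> interior B" "y \<in> frontier B" "y' \<in> frontier B"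
    and "y \<in> closed_segment p x" "y' \<in> closed_segment p x"
  shows "y = y'"
proof -
  have *: "\<not> s < t" if y: "p + s *\<^sub>R (x - p) \<in> frontier B" "p + t *\<^sub>R (x - p) \<in> frontier B"
    and "0 \<le> s" for s t
  proof
    assume "s < t"
    let ?z = "p + t *\<^sub>R (x - p)"
    have "s \<noteq> 0" "x \<noteq> p"
      using y(1) assms(2) by (auto simp: frontier_def)
    with \<open>s < t\<close> \<open>0 \<le> s\<close> have "p + s *\<^sub>R (x - p) \<in> open_segment p ?z"
      by (auto simp: in_segment algebra_simps intro!: exI[of _ "s / t"])
    also have "\<dots> \<subseteq> interior B"
      using y(2) assms(1,2) by (intro in_interior_closure_convex_segment) (auto simp: frontier_def)
    finally show False using y(1) by (auto simp: frontier_def)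
  qed
  obtain s t where st: "0 \<le> s" "0 \<le> t" "y = p + s *\<^sub>R (x - p)" "y' = p + t *\<^sub>R (x - p)"
    using assms(5,6) by (auto simp: in_segment algebra_simps)
  with *[of s t] *[of t s] assms(3,4) show ?thesis by force
qed

lemma radial_frontier_exists:
  fixes B :: "'a::euclidean_space set"
  assumes "p \<in> interior B" "x \<notin> interior B"
  shows "\<exists>y. y \<in> closed_segment p x \<and> y \<in> frontier B"
proof (cases "x \<in> B")
  case True
  then have "x \<in> frontier B" using assms closure_subset by (auto simp: frontier_def)
  then show ?thesis by auto
next
  case False
  have "p \<in> B" using assms(1) interior_subset by auto
  then have "closed_segment p x \<inter> frontier B \<noteq> {}"
    using False by (intro connected_Int_frontier) auto
  then show ?thesis by auto
qed

lemma convex_tube: "convex (tube v p e)"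
  and compact_tube: "compact (tube v p e)"
proof -
  have eq: "tube v p e = (\<Union>x\<in>closed_segment v p. \<Union>y\<in>cball 0 e. {x + y})"
    unfolding tube_def by blast
  show "convex (tube v p e)" unfolding eq by (intro convex_sums) auto
  show "compact (tube v p e)" unfolding eq by (intro compact_sums') auto
qed

lemma tubeI: "x \<in> closed_segment v p \<Longrightarrow> dist x y \<le> e \<Longrightarrow> y \<in> tube v p e"
  unfolding tube_def
  by (intro CollectI exI[of _ x] exI[of _ "y - x"]) (auto simp: dist_norm norm_minus_commute)

lemma centre_in_tube_interior: "e > 0 \<Longrightarrow> p \<in> interior (tube v p e)"
  unfolding mem_interior by (intro exI[of _ e]) (auto intro!: tubeI)

text \<open>
  A description of the graph by two conditions that overlap on the frontier, where they agree.
  Unlike the case distinction on membership of the tube, both are closed.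
\<close>
lemma tube_retraction_iff:
  assumes "e > 0"
  shows "tube_retraction v p e x = y \<longleftrightarrow>
    (x \<in> tube v p e \<and> y = x) \<or>
    (x \<notin> interior (tube v p e) \<and> y \<in> frontier (tube v p e) \<and> y \<in> closed_segment p x)"
proof -
  let ?B = "tube v p e"
  note p = centre_in_tube_interior[OF assms, of p v]
  note unique = radial_frontier_unique[OF convex_tube p]
  show ?thesis
  proof (cases "x \<in> ?B")
    case True
    have "y = x" if "x \<notin> interior ?B" "y \<in> frontier ?B" "y \<in> closed_segment p x"
    proof (rule unique[OF that(2) _ that(3)])
      show "x \<in> frontier ?B" using True that(1) closure_subset by (auto simp: frontier_def)
    qed simp
    with True show ?thesis by (auto simp: tube_retraction_def)
  next
    case False
    then have x: "x \<notin> interior ?B" using interior_subset by auto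
    obtain z where z: "z \<in> closed_segment p x" "z \<in> frontier ?B"
      using radial_frontier_exists[OF p x] by auto
    have "tube_retraction v p e x = z"
      unfolding tube_retraction_def if_not_P[OF False]
    proof (rule the_equality)
      show "z \<in> closed_segment p x \<inter> frontier ?B" using z by simp
      show "y = z" if "y \<in> closed_segment p x \<inter> frontier ?B" for y
        using that z by (intro unique[of y z x]) simp_all
    qed
    moreover have "y = z" if "y \<in> frontier ?B" "y \<in> closed_segment p x"
      using that z by (intro unique[of y z x])
    ultimately show ?thesis using False x z by metis
  qed
qed

text \<open>
  The frontier of the tube is compact, so it is enough that the graph is closed; and the graph is
  described by closed conditions, membership of a segment being an equation between distances.
\<close>
lemma continuous_on_tube_retraction:
  assumes "e > 0"
  shows "continuous_on S (tube_retraction v p e)"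
proof (rule continuous_on_subset)
  let ?B = "tube v p e" and ?f = "tube_retraction v p e"
  show "continuous_on UNIV ?f"
  proof (rule continuous_from_closed_graph[OF compact_tube])
    have cl: "closed ?B" by (simp add: compact_imp_closed compact_tube)
    show "?f \<in> UNIV \<rightarrow> ?B"
    proof
      show "?f x \<in> ?B" for x
        using tube_retraction_iff[OF assms, of v p x "?f x"] frontier_subset_closed[OF cl] by auto
    qed
    have segment: "y \<in> closed_segment p x \<longleftrightarrow> dist p x = dist p y + dist y x" for x y
      by (simp only: between_mem_segment[symmetric] between)
    have *: "(\<lambda>x. (x, ?f x)) ` UNIV = (?B \<times> UNIV \<inter> {z. snd z = fst z}) \<union>
        ((- interior ?B) \<times> frontier ?B \<inter> {z. dist p (fst z) = dist p (snd z) + dist (snd z) (fst z)})"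
      (is "?L = ?R")
    proof (rule Set.set_eqI)
      fix z :: "(complex^'a) \<times> (complex^'a)"
      obtain x y where z: "z = (x, y)" by (cases z)
      have "z \<in> ?L \<longleftrightarrow> ?f x = y" unfolding z by auto
      also have "\<dots> \<longleftrightarrow> z \<in> ?R"
        unfolding tube_retraction_iff[OF assms] segment z by simp
      finally show "z \<in> ?L \<longleftrightarrow> z \<in> ?R" .
    qed
    show "closed ((\<lambda>x. (x, ?f x)) ` UNIV)"
      unfolding * by (intro closed_Un closed_Int closed_Times cl closed_Collect_eq continuous_intros) auto
  qed
qed simp

section \<open>Keyhole loops\<close>

definition keyhole_radius :: "real \<Rightarrow> real \<Rightarrow> real" where
  "keyhole_radius d t = max d (max (1 - 3 * t) (3 * t - 2))"

definition keyhole_angle :: "real \<Rightarrow> real" where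
  "keyhole_angle t = max 0 (min 1 (3 * t - 1))"

text \<open>
  A loop in \<open>\<complex> - {0}\<close> based at 1, for \<open>0 < d \<le> 1\<close>: it runs
  along the real axis to \<open>d\<close>, once around the circle of radius \<open>d\<close>, and
  back, each in a third of the time. Writing it as one radius times one exponential, with radius
  and angle clamped to their intervals, gives continuity without cases and an explicit logarithm.
\<close>
definition keyhole :: "real \<Rightarrow> real \<Rightarrow> complex" where
  "keyhole d t = of_real (keyhole_radius d t) * exp (2 * of_real pi * \<i> * of_real (keyhole_angle t))"

lemma continuous_on_keyhole_radius: "continuous_on S (keyhole_radius d)"
  and continuous_on_keyhole_angle: "continuous_on S keyhole_angle"
  unfolding keyhole_radius_def[abs_def] keyhole_angle_def[abs_def] by (auto intro!: continuous_intros)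

lemma continuous_on_keyhole: "continuous_on S (keyhole d)"
  unfolding keyhole_def[abs_def]
  by (intro continuous_intros continuous_on_keyhole_radius continuous_on_keyhole_angle)

lemma continuous_on_keyhole_compose [continuous_intros]:
  "continuous_on S f \<Longrightarrow> continuous_on S (\<lambda>x. keyhole d (f x))"
  by (rule continuous_on_compose2[OF continuous_on_keyhole[of UNIV]]) auto

lemma exp_two_pi_i_mult: "exp (2 * of_real pi * \<i>) = 1"
  using exp_two_pi_i by (simp add: mult_ac)

lemma keyhole_ends:
  assumes "d \<le> 1" shows "keyhole d 0 = 1" "keyhole d 1 = 1"
  using assms by (auto simp: keyhole_def keyhole_radius_def keyhole_angle_def exp_two_pi_i_mult)

lemma keyhole_radius_pos: "d > 0 \<Longrightarrow> keyhole_radius d t > 0"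
  by (simp add: keyhole_radius_def)

lemma keyhole_nonzero: "d > 0 \<Longrightarrow> keyhole d t \<noteq> 0"
  using keyhole_radius_pos[of d t] by (simp add: keyhole_def)

lemma keyhole_cases:
  assumes "0 < d" "d \<le> 1" "t \<in> {0..1}"
  obtains r where "r \<in> {0..1}" "keyhole d t = of_real r" | "norm (keyhole d t) \<le> d"
proof -
  consider "t \<le> 1/3" | "t \<ge> 2/3" | "1/3 < t" "t < 2/3" by linarith
  then show thesis
  proof cases
    case 1
    with that(1)[of "keyhole_radius d t"] assms show thesis
      by (auto simp: keyhole_def keyhole_angle_def keyhole_radius_def)
  next
    case 2
    with that(1)[of "keyhole_radius d t"] assms show thesis
      by (auto simp: keyhole_def keyhole_angle_def keyhole_radius_def exp_two_pi_i_mult min_def)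
  next
    case 3
    then have "keyhole_radius d t = d" using assms(1) by (simp add: keyhole_radius_def)
    with that(2) assms show thesis
      by (simp add: keyhole_def norm_mult mult_ac)
  qed
qed

text \<open>
  The keyhole transported to the complex line through \<open>v\<close> with direction
  \<open>w\<close>: the value 1 corresponds to \<open>v\<close> and the value 0 to \<open>v -
  w\<close>, the point around which the loop turns.
\<close>
definition keyhole_loop :: "real \<Rightarrow> complex^'n \<Rightarrow> complex^'n \<Rightarrow> real \<Rightarrow> complex^'n" where
  "keyhole_loop d v w t = v - (1 - keyhole d t) *s w"

context central_arrangement
begin

text \<open>
  Hyperplanes that do not contain \<open>X\<close> miss the tube, in which the image lies. On the
  others the form vanishes at \<open>p\<close>, so along a ray from \<open>p\<close> it is only
  rescaled.
\<close>
lemma tube_retraction_complement: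
  assumes X: "p \<in> X" and e: "admissible_radius A v X p e"
    and x: "x \<in> complement (localization A X)"
  shows "tube_retraction v p e x \<in> complement A"
proof -
  let ?B = "tube v p e"
  have e0: "e > 0" using e by (simp add: admissible_radius_def)
  define y where "y = tube_retraction v p e x"
  have "lin H y \<noteq> 0" if H: "H \<in> A" for H
  proof (cases "X \<subseteq> H")
    case False
    have "y \<in> ?B"
      using tube_retraction_iff[OF e0, of v p x y] compact_imp_closed[OF compact_tube, of v p e]
        frontier_subset_closed by (auto simp: y_def)
    moreover have "?B \<inter> H = {}"
      using e False H by (auto simp: admissible_radius_def)
    ultimately show ?thesis using H mem_hyperplane by auto
  next
    case True
    then have lx: "lin H x \<noteq> 0"
      using x H mem_hyperplane by (auto simp: complement_def localization_def)
    have lp: "lin H p = 0" using X True H mem_hyperplane by auto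
    consider "y = x" | "y \<in> frontier ?B" "y \<in> closed_segment p x"
      using tube_retraction_iff[OF e0, of v p x y] by (auto simp: y_def)
    then show ?thesis
    proof cases
      case 1 then show ?thesis using lx by simp
    next
      case 2
      then obtain u where u: "y = (1 - u) *\<^sub>R p + u *\<^sub>R x" by (auto simp: in_segment)
      have "u \<noteq> 0"
        using 2 u centre_in_tube_interior[OF e0, of p v] by (auto simp: frontier_def)
      then show ?thesis
        using lx lp by (simp add: u form_add form_diff scaleR_eq_smult form_scale)
    qed
  qed
  then show ?thesis by (simp add: mem_complement y_def)
qed

lemma keyhole_loop_in_tube:
  assumes "e > 0" "d * norm (v - p) \<le> e" "0 < d" "d \<le> 1" "t \<in> {0..1}"
  shows "keyhole_loop d v (v - p) t \<in> tube v p e"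
proof -
  have eq: "keyhole_loop d v (v - p) t = p + keyhole d t *s (v - p)"
    by (simp add: keyhole_loop_def vec_eq_iff algebra_simps)
  from assms(3-5) show ?thesis
  proof (cases rule: keyhole_cases)
    case (1 r)
    then have "keyhole_loop d v (v - p) t \<in> closed_segment v p"
      unfolding eq in_segment
      by (intro conjI exI[of _ "1 - r"]) (auto simp: scaleR_eq_smult vec_eq_iff algebra_simps)
    with assms(1) show ?thesis by (auto intro!: tubeI[of _ _ _ _ e] simp: less_imp_le)
  next
    case 2
    then have "norm (keyhole d t *s (v - p)) \<le> d * norm (v - p)"
      unfolding norm_smult by (rule mult_right_mono) simp
    then have "norm (keyhole d t *s (v - p)) \<le> e" using assms(2) by (rule order_trans)
    moreover have "p + c \<in> tube v p e" if "norm c \<le> e" for c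
      using that by (intro tubeI[of p]) (auto simp: dist_norm)
    ultimately show ?thesis unfolding eq by blast
  qed
qed

text \<open>
  In the complement of the localization the rotation of \<open>v\<close> is homotopic to the
  keyhole loop around \<open>p\<close>: all its forms vanish at \<open>p\<close>, so only the
  scalar loops matter, and these are homotopic in \<open>\<complex> - {0}\<close>. For small
  \<open>d\<close> the keyhole loop lies in the tube, where the retraction is the identity. Thus
  the class is given by an explicit loop, the same for every small \<open>d\<close>.
\<close>
lemma gamma_eq_keyhole:
  assumes v: "v \<in> complement A" and X: "p \<in> X"
    and e: "admissible_radius A v X p e"
    and d: "0 < d" "d \<le> 1" "d * norm (v - p) \<le> e"
  shows "gamma A v X p e = loop_class (complement_top A) v (keyhole_loop d v (v - p))"
    and "loopin (complement_top A) v (keyhole_loop d v (v - p))"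
proof -
  let ?M = "complement_top (localization A X)" and ?f = "tube_retraction v p e"
  let ?g = "keyhole_loop d v (v - p)"
  have e0: "e > 0" using e by (simp add: admissible_radius_def)
  have loc: "x \<in> complement (localization A X) \<longleftrightarrow> (\<forall>H\<in>A. X \<subseteq> H \<longrightarrow> lin H x \<noteq> 0)" for x
    by (auto simp: complement_def localization_def mem_hyperplane)
  have f: "continuous_map ?M (complement_top A) ?f"
    unfolding complement_top_def
    using tube_retraction_complement[OF X e]
    by (auto simp: continuous_on_tube_retraction[OF e0])
  have fv: "?f v = v"
    using tubeI[of v v p v e] e0 by (simp add: tube_retraction_def)
  \<comment> \<open>Interpolation of radius and angle between rotation and keyhole, while the term in \<open>p\<close> moves the
    centre from 0 to \<open>p\<close>; the factor \<open>1 - keyhole d t\<close> keeps the ends at \<open>v\<close>.\<close>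
  define r where "r z = (1 - fst z) + fst z * keyhole_radius d (snd z)" for z :: "real \<times> real"
  define a where "a z = (1 - fst z) * snd z + fst z * keyhole_angle (snd z)" for z :: "real \<times> real"
  define h where "h z = (of_real (r z) * exp (2 * of_real pi * \<i> * of_real (a z))) *s v
      + (of_real (fst z) * (1 - keyhole d (snd z))) *s p" for z
  have rpos: "r z > 0" if "z \<in> {0..1} \<times> {0..1}" for z
    using keyhole_radius_pos[OF d(1), of "snd z"] that unfolding r_def
    by (cases "fst z = 0") (auto intro!: add_nonneg_pos)
  have "loop_homotopic ?M v (\<lambda>t. exp (2 * of_real pi * \<i> * of_real t) *s v) ?g"
  proof (rule loop_homotopicI[of _ h])
    have "continuous_on ({0..1} \<times> {0..1}) h"
      unfolding h_def r_def a_def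
      by (intro continuous_intros continuous_on_compose2[OF continuous_on_keyhole_radius[of UNIV]]
           continuous_on_compose2[OF continuous_on_keyhole_angle[of UNIV]]) auto
    moreover have "h z \<in> complement (localization A X)" if "z \<in> {0..1} \<times> {0..1}" for z
      unfolding loc
    proof (intro ballI impI)
      fix H assume "H \<in> A" "X \<subseteq> H"
      then have "lin H p = 0" using X mem_hyperplane by auto
      moreover have "lin H v \<noteq> 0" using v \<open>H \<in> A\<close> by (simp add: mem_complement)
      ultimately show "lin H (h z) \<noteq> 0"
        using rpos[OF that] by (simp add: h_def form_add form_scale)
    qed
    ultimately show "continuous_map unit_square ?M h"
      by (auto simp: complement_top_def)
  next
    fix t show "h (1, t) = ?g t"
      by (simp add: h_def r_def a_def keyhole_loop_def keyhole_def vec_eq_iff algebra_simps)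
  qed (use d keyhole_ends[of d] in \<open>simp_all add: h_def r_def a_def
         keyhole_angle_def keyhole_radius_def exp_two_pi_i_mult\<close>)
  then have hom: "loop_homotopic ?M v (\<lambda>t. exp (2 * of_real pi * \<i> * of_real t) *s v) ?g" .
  have eq: "gamma A v X p e = loop_class (complement_top A) v (?f \<circ> ?g)"
    unfolding gamma_def gamma0_def loop_class_eqI[OF hom]
    by (rule induced_map_loop_class[OF loop_homotopic_loopin(2)[OF hom] f fv])
  have hom': "loop_homotopic (complement_top A) v (?f \<circ> ?g) ?g"
  proof (rule loop_homotopic_cong)
    show "loopin (complement_top A) v (?f \<circ> ?g)"
      by (rule loopin_compose[OF loop_homotopic_loopin(2)[OF hom] f fv])
    show "(?f \<circ> ?g) t = ?g t" if "t \<in> {0..1}" for t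
      using keyhole_loop_in_tube[OF e0 d(3,1,2) that] by (simp add: tube_retraction_def)
  qed
  show "gamma A v X p e = loop_class (complement_top A) v ?g"
    using eq loop_class_eqI[OF hom'] by (rule trans)
  show "loopin (complement_top A) v ?g"
    by (rule loop_homotopic_loopin(2)[OF hom'])
qed

end

section \<open>Commuting loops\<close>

text \<open>
  The two concatenations are the images of the two ways around the boundary of the square, from
  one corner to the opposite one.
\<close>
lemma torus_loops_commute:
  assumes F: "continuous_map unit_square X F"
    and f: "\<And>x. x \<in> {0..1} \<Longrightarrow> F (x, 0) = f x" "\<And>x. x \<in> {0..1} \<Longrightarrow> F (x, 1) = f x"
    and g: "\<And>y. y \<in> {0..1} \<Longrightarrow> F (0, y) = g y" "\<And>y. y \<in> {0..1} \<Longrightarrow> F (1, y) = g y"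
    and a: "f 0 = a"
  shows "loop_homotopic X a (concat_loops f g) (concat_loops g f)"
proof -
  let ?a = "\<lambda>t::real. min 1 (2 * t)" and ?b = "\<lambda>t::real. max 0 (2 * t - 1)"
  let ?p = "\<lambda>t. (?a t, ?b t)" and ?q = "\<lambda>t. (?b t, ?a t)"
  have ends: "F (0, 0) = a" "F (1, 1) = a"
    using f(1)[of 0] f(2)[of 1] g(1)[of 0] g(2)[of 0] g(2)[of 1] f(1)[of 1] g(1)[of 1] f(2)[of 0] a by auto
  have hom: "loop_homotopic X a (F \<circ> ?p) (F \<circ> ?q)"
  proof (rule reparametrization_homotopic[where S = "{0..1} \<times> {0..1}"])
    show "continuous_map (top_of_set ({0..1} \<times> {0..1})) X F"
      using F by (simp only: prod_topology_subtopology_eu)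
    show "continuous_on {0..1} ?p" "continuous_on {0..1} ?q" by (intro continuous_intros)+
  qed (auto simp: ends convex_Times)
  have fg: "(F \<circ> ?p) t = concat_loops f g t" and gf: "(F \<circ> ?q) t = concat_loops g f t"
    if "t \<in> {0..1}" for t
  proof -
    have "(F \<circ> ?p) t = concat_loops f g t \<and> (F \<circ> ?q) t = concat_loops g f t"
    proof (cases "t \<le> 1/2")
      case True
      then have "?a t = 2 * t" "?b t = 0" by auto
      then show ?thesis using True that f(1)[of "2 * t"] g(1)[of "2 * t"] by (simp add: concat_loops_def)
    next
      case False
      then have "?a t = 1" "?b t = 2 * t - 1" by auto
      then show ?thesis using False that f(2)[of "2 * t - 1"] g(2)[of "2 * t - 1"]
        by (simp add: concat_loops_def)
    qed
    then show "(F \<circ> ?p) t = concat_loops f g t" "(F \<circ> ?q) t = concat_loops g f t" by auto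
  qed
  have "loop_homotopic X a (concat_loops f g) (F \<circ> ?p)"
    by (rule loop_homotopic_sym, rule loop_homotopic_cong[OF loop_homotopic_loopin(1)[OF hom] fg])
  also note hom
  also have "loop_homotopic X a (F \<circ> ?q) (concat_loops g f)"
    by (rule loop_homotopic_cong[OF loop_homotopic_loopin(2)[OF hom] gf])
  finally show ?thesis .
qed

text \<open>
  The factors \<open>1 - keyhole d t\<close>, and their products with a keyhole, are within a
  small error of real numbers in \<open>[0, 1]\<close>. For them half-plane estimates that hold
  for nonnegative real factors survive, up to that error.
\<close>
definition nearly_nonneg :: "real \<Rightarrow> complex \<Rightarrow> bool" where
  "nearly_nonneg e z \<longleftrightarrow> (\<exists>r\<ge>0. norm (z - of_real r) \<le> e)"

lemma Re_mult_nearly_nonneg: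
  assumes "nearly_nonneg e z" "Re c \<le> 0"
  shows "Re (z * c) \<le> e * norm c"
proof -
  obtain r where r: "r \<ge> 0" "norm (z - of_real r) \<le> e"
    using assms(1) by (auto simp: nearly_nonneg_def)
  have "z * c = of_real r * c + (z - of_real r) * c" by (simp add: algebra_simps)
  then have "Re (z * c) = r * Re c + Re ((z - of_real r) * c)" by simp
  also have "\<dots> \<le> 0 + norm ((z - of_real r) * c)"
    using r assms(2) by (intro add_mono mult_nonneg_nonpos complex_Re_le_cmod)
  also have "\<dots> \<le> e * norm c"
    using r by (simp add: norm_mult mult_right_mono)
  finally show ?thesis .
qed

lemma nearly_nonneg_mono: "nearly_nonneg e z \<Longrightarrow> e \<le> e' \<Longrightarrow> nearly_nonneg e' z"
  unfolding nearly_nonneg_def by (meson order_trans)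

lemma keyhole_nearly_nonneg:
  assumes "0 < d" "d \<le> 1" "t \<in> {0..1}"
  shows "nearly_nonneg d (1 - keyhole d t)"
  using assms
proof (cases rule: keyhole_cases)
  case (1 r) then show ?thesis
    unfolding nearly_nonneg_def using assms by (intro exI[of _ "1 - r"]) auto
next
  case 2 then show ?thesis
    unfolding nearly_nonneg_def by (intro exI[of _ 1]) auto
qed

text \<open>
  Each keyhole value is a real number in \<open>[0, 1]\<close> or of modulus at most
  \<open>d\<close>; the four combinations are checked.
\<close>
lemma keyhole_product_nearly_nonneg:
  assumes d: "0 < d" "d \<le> 1" and s: "s \<in> {0..1}" and t: "t \<in> {0..1}"
  shows "nearly_nonneg (2 * d) (keyhole d s * (1 - keyhole d t))"
  using d t
proof (cases rule: keyhole_cases)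
  case (1 r)
  note r = 1
  from d s show ?thesis
  proof (cases rule: keyhole_cases)
    case (1 q)
    have "keyhole d s * (1 - keyhole d t) = of_real (q * (1 - r))"
      unfolding 1(2) r(2) by simp
    moreover have "0 \<le> q * (1 - r)" using r(1) 1(1) by simp
    ultimately show ?thesis
      unfolding nearly_nonneg_def using d by (intro exI[of _ "q * (1 - r)"]) simp
  next
    case 2
    have "norm (1 - keyhole d t) \<le> 1"
    proof -
      have "1 - keyhole d t = of_real (1 - r)" unfolding r(2) by simp
      then show ?thesis using r(1) by (simp only: norm_of_real) simp
    qed
    then have "norm (keyhole d s) * norm (1 - keyhole d t) \<le> d * 1"
      using 2 d by (intro mult_mono) auto
    then show ?thesis
      unfolding nearly_nonneg_def using d by (intro exI[of _ 0]) (auto simp: norm_mult)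
  qed
next
  case 2
  have n1: "norm (keyhole d s) \<le> 1"
    using d s by (cases rule: keyhole_cases) (auto intro: order_trans[OF _ d(2)])
  note t2 = 2
  from d s show ?thesis
  proof (cases rule: keyhole_cases)
    case (1 q)
    have "norm (keyhole d s) * norm (keyhole d t) \<le> 1 * d"
      using t2 n1 d by (intro mult_mono) auto
    then have "norm (keyhole d s * (1 - keyhole d t) - of_real q) \<le> 2 * d"
      using 1 d by (simp add: algebra_simps norm_mult)
    then show ?thesis unfolding nearly_nonneg_def using 1 by auto
  next
    case 2
    have "norm (1 - keyhole d t) \<le> 1 + norm (keyhole d t)"
      using norm_triangle_ineq4[of 1 "keyhole d t"] by simp
    also have "\<dots> \<le> 2" using t2 d by simp
    finally have "norm (keyhole d s) * norm (1 - keyhole d t) \<le> d * 2"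
      using 2 d by (intro mult_mono) auto
    then show ?thesis
      unfolding nearly_nonneg_def using d by (intro exI[of _ 0]) (auto simp: norm_mult)
  qed
qed

text \<open>
  With exactly nonnegative factors the real part of \<open>h\<close> times the difference would be
  at least that of \<open>h * a\<close>; the errors of the factors are too small to use this up.
\<close>
lemma half_plane_nonzero:
  assumes v: "Re (h * a) > 0" and b: "Re (h * b) \<le> 0" and c: "Re (h * c) \<le> 0"
    and y: "nearly_nonneg (2 * d) y" and z: "nearly_nonneg (2 * d) z"
    and d: "d > 0" "2 * d * (norm (h * b) + norm (h * c)) < Re (h * a)"
  shows "a - y * b - z * c \<noteq> 0" "Re (h * (a - y * b - z * c)) > 0"
proof -
  have "Re (y * (h * b)) \<le> 2 * d * norm (h * b)" "Re (z * (h * c)) \<le> 2 * d * norm (h * c)"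
    by (rule Re_mult_nearly_nonneg; fact)+
  moreover have "Re (h * (a - y * b - z * c)) = Re (h * a) - Re (y * (h * b)) - Re (z * (h * c))"
    by (simp only: minus_complex.simps(1)[symmetric] right_diff_distrib mult.left_commute)
  ultimately show pos: "Re (h * (a - y * b - z * c)) > 0"
    using d(2) distrib_left[of "2 * d" "norm (h * b)" "norm (h * c)"] by linarith
  show "a - y * b - z * c \<noteq> 0"
  proof
    assume "a - y * b - z * c = 0"
    with pos show False by (simp only: mult_zero_right) simp
  qed
qed

lemma half_plane_nonzero1:
  assumes "Re (h * a) > 0" "Re (h * b) \<le> 0" "nearly_nonneg (2 * d) y" "d > 0"
    "2 * d * norm (h * b) < Re (h * a)"
  shows "a - y * b \<noteq> 0" "Re (h * (a - y * b)) > 0"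
proof -
  have "Re (h * 0) \<le> 0" "nearly_nonneg (2 * d) 0"
    using assms(4) by (auto simp: nearly_nonneg_def)
  moreover have "2 * d * (norm (h * b) + norm (h * 0)) < Re (h * a)"
    using assms(5) by (simp only: mult_zero_right norm_zero add_0_right)
  ultimately have "a - y * b - 0 * 0 \<noteq> 0" "Re (h * (a - y * b - 0 * 0)) > 0"
    using assms half_plane_nonzero[of h a b 0 d y 0] by (simp_all only: simp_thms)
  then show "a - y * b \<noteq> 0" "Re (h * (a - y * b)) > 0"
    by (simp_all only: mult_zero_right diff_zero not_False_eq_True)
qed

context central_arrangement
begin

text \<open>
  The point chosen in \<open>X\<close> is \<open>v - w X\<close>. The second clause makes the
  loops of two incomparable flats independent of each other on the hyperplanes below either of
  them. The third clause says that, for each hyperplane \<open>H\<close>, some real line through 0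
  has the value of its form at \<open>v\<close> strictly on one side and the values at all
  relevant shifts on the other side or on the line, so that subtracting nonnegative multiples of
  shifts from \<open>v\<close> never leads to \<open>H\<close>; one such condition controls
  segments, triangles and parallelograms at once.
\<close>
definition compatible_shifts ::
  "(complex^'n) set set \<Rightarrow> complex^'n \<Rightarrow> ((complex^'n) set \<Rightarrow> complex^'n) \<Rightarrow> bool" where
  "compatible_shifts S v w \<longleftrightarrow>
     (\<forall>X\<in>S. v - w X \<in> X) \<and>
     (\<forall>X\<in>S. \<forall>Y\<in>S. \<not> X \<subseteq> Y \<longrightarrow> \<not> Y \<subseteq> X \<longrightarrow> w X \<in> Y) \<and>
     (\<forall>H\<in>A. \<exists>h. Re (h * lin H v) > 0 \<and> (\<forall>X\<in>S. \<not> X \<subseteq> H \<longrightarrow> Re (h * lin H (w X)) \<le> 0))"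

lemma compatible_shift_lin:
  assumes "compatible_shifts S v w" "X \<in> S" "H \<in> A" "X \<subseteq> H"
  shows "lin H (w X) = lin H v"
proof -
  have "v - w X \<in> H" using assms by (auto simp: compatible_shifts_def)
  then show ?thesis using mem_hyperplane[OF assms(3)] by (simp add: form_diff)
qed

text \<open>
  The two loops span a torus: the loop around the smaller set \<open>Y\<close> rescales the whole
  displacement of the loop around \<open>X\<close>. On a hyperplane containing both flats the form
  is multiplied by both keyholes, on one that contains only \<open>Y\<close> it is the keyhole of
  \<open>Y\<close> times a value in a half plane, and on the others it stays in a half plane.
\<close>
lemma comparable_keyhole_loops_commute:
  assumes comp: "compatible_shifts S v w" and v: "v \<in> complement A"
    and XY: "X \<in> S" "Y \<in> S" "Y \<subseteq> X" and d: "0 < d" "d \<le> 1"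
    and h: "\<And>H. H \<in> A \<Longrightarrow> Re (h H * lin H v) > 0"
      "\<And>H Z. H \<in> A \<Longrightarrow> Z \<in> S \<Longrightarrow> \<not> Z \<subseteq> H \<Longrightarrow> Re (h H * lin H (w Z)) \<le> 0"
    and small: "\<And>H. H \<in> A \<Longrightarrow>
      2 * d * (norm (h H * lin H (w X)) + norm (h H * lin H (w Y))) < Re (h H * lin H v)"
  shows "loop_homotopic (complement_top A) v
    (concat_loops (keyhole_loop d v (w X)) (keyhole_loop d v (w Y)))
    (concat_loops (keyhole_loop d v (w Y)) (keyhole_loop d v (w X)))"
proof -
  define F where "F z = v - (1 - keyhole d (snd z)) *s w Y
      - (keyhole d (snd z) * (1 - keyhole d (fst z))) *s w X" for z
  have "F z \<in> complement A" if z: "z \<in> {0..1} \<times> {0..1}" for z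
    unfolding mem_complement
  proof
    fix H assume H: "H \<in> A"
    have lv: "lin H v \<noteq> 0" using v H by (simp add: mem_complement)
    have st: "fst z \<in> {0..1}" "snd z \<in> {0..1}" using z by auto
    note k = keyhole_nonzero[OF d(1)]
    note one = nearly_nonneg_mono[OF keyhole_nearly_nonneg[OF d], of _ "2 * d"]
    have small': "2 * d * norm (h H * lin H (w X)) < Re (h H * lin H v)"
      by (rule le_less_trans[OF mult_left_mono small[OF H]]) (use d in auto)
    have eq: "lin H (F z) = lin H v - (1 - keyhole d (snd z)) * lin H (w Y)
        - keyhole d (snd z) * (1 - keyhole d (fst z)) * lin H (w X)"
      by (simp only: F_def form_diff form_scale)
    consider "X \<subseteq> H" | "Y \<subseteq> H" "\<not> X \<subseteq> H" | "\<not> Y \<subseteq> H" "\<not> X \<subseteq> H"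
      using XY(3) by auto
    then show "lin H (F z) \<noteq> 0"
    proof cases
      case 1
      then have "lin H (w X) = lin H v" "lin H (w Y) = lin H v"
        using compatible_shift_lin[OF comp _ H] XY by auto
      then have "lin H (F z) = keyhole d (snd z) * keyhole d (fst z) * lin H v"
        by (simp add: eq algebra_simps)
      then show ?thesis using k lv by simp
    next
      case 2
      then have "lin H (w Y) = lin H v"
        using compatible_shift_lin[OF comp _ H] XY by auto
      then have "lin H (F z) = keyhole d (snd z) * (lin H v - (1 - keyhole d (fst z)) * lin H (w X))"
        by (simp add: eq algebra_simps)
      moreover have "lin H v - (1 - keyhole d (fst z)) * lin H (w X) \<noteq> 0"
        by (rule half_plane_nonzero1[OF h(1)[OF H] h(2)[OF H XY(1) 2(2)] one[OF st(1)] d(1) small'])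
           (use d in simp)
      ultimately show ?thesis using k by simp
    next
      case 3
      show ?thesis
        unfolding eq
        by (rule half_plane_nonzero[OF h(1)[OF H] h(2)[OF H XY(2) 3(1)] h(2)[OF H XY(1) 3(2)]
             one[OF st(2)] keyhole_product_nearly_nonneg[OF d st(2,1)] d(1)])
           (use d small[OF H] in \<open>simp_all add: add.commute\<close>)
    qed
  qed
  moreover have "continuous_on ({0..1} \<times> {0..1}) F"
    unfolding F_def by (intro continuous_intros)
  ultimately have "continuous_map unit_square (complement_top A) F"
    by (auto simp: complement_top_def)
  then show ?thesis
    by (rule torus_loops_commute)
       (simp_all add: F_def keyhole_loop_def keyhole_ends[OF d(2)])
qed

text \<open>
  Here the torus is the sum of the two displacements. Since each shift lies in the other flat, a
  hyperplane containing one of the flats sees only the loop around that flat.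
\<close>
lemma incomparable_keyhole_loops_commute:
  assumes comp: "compatible_shifts S v w" and v: "v \<in> complement A"
    and XY: "X \<in> S" "Y \<in> S" "\<not> X \<subseteq> Y" "\<not> Y \<subseteq> X" and d: "0 < d" "d \<le> 1"
    and h: "\<And>H. H \<in> A \<Longrightarrow> Re (h H * lin H v) > 0"
      "\<And>H Z. H \<in> A \<Longrightarrow> Z \<in> S \<Longrightarrow> \<not> Z \<subseteq> H \<Longrightarrow> Re (h H * lin H (w Z)) \<le> 0"
    and small: "\<And>H. H \<in> A \<Longrightarrow>
      2 * d * (norm (h H * lin H (w X)) + norm (h H * lin H (w Y))) < Re (h H * lin H v)"
  shows "loop_homotopic (complement_top A) v
    (concat_loops (keyhole_loop d v (w X)) (keyhole_loop d v (w Y)))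
    (concat_loops (keyhole_loop d v (w Y)) (keyhole_loop d v (w X)))"
proof -
  define F where "F z = v - (1 - keyhole d (fst z)) *s w X - (1 - keyhole d (snd z)) *s w Y" for z
  have wX: "w X \<in> Y" and wY: "w Y \<in> X" using comp XY by (auto simp: compatible_shifts_def)
  have "F z \<in> complement A" if z: "z \<in> {0..1} \<times> {0..1}" for z
    unfolding mem_complement
  proof
    fix H assume H: "H \<in> A"
    have lv: "lin H v \<noteq> 0" using v H by (simp add: mem_complement)
    have st: "fst z \<in> {0..1}" "snd z \<in> {0..1}" using z by auto
    note k = keyhole_nonzero[OF d(1)]
    note one = nearly_nonneg_mono[OF keyhole_nearly_nonneg[OF d], of _ "2 * d"]
    have eq: "lin H (F z) = lin H v - (1 - keyhole d (fst z)) * lin H (w X)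
        - (1 - keyhole d (snd z)) * lin H (w Y)"
      by (simp only: F_def form_diff form_scale)
    consider "X \<subseteq> H" | "Y \<subseteq> H" | "\<not> Y \<subseteq> H" "\<not> X \<subseteq> H" by auto
    then show "lin H (F z) \<noteq> 0"
    proof cases
      case 1
      then have "lin H (w X) = lin H v" "lin H (w Y) = 0"
        using compatible_shift_lin[OF comp _ H] XY wY mem_hyperplane[OF H] by auto
      then have "lin H (F z) = keyhole d (fst z) * lin H v"
        by (simp add: eq algebra_simps)
      then show ?thesis using k lv by simp
    next
      case 2
      then have "lin H (w Y) = lin H v" "lin H (w X) = 0"
        using compatible_shift_lin[OF comp _ H] XY wX mem_hyperplane[OF H] by auto
      then have "lin H (F z) = keyhole d (snd z) * lin H v"
        by (simp add: eq algebra_simps)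
      then show ?thesis using k lv by simp
    next
      case 3
      show ?thesis
        unfolding eq
        by (rule half_plane_nonzero[OF h(1)[OF H] h(2)[OF H XY(1) 3(2)] h(2)[OF H XY(2) 3(1)]
             one[OF st(1)] one[OF st(2)] d(1) small[OF H]])
           (use d in simp_all)
    qed
  qed
  moreover have "continuous_on ({0..1} \<times> {0..1}) F"
    unfolding F_def by (intro continuous_intros)
  ultimately have "continuous_map unit_square (complement_top A) F"
    by (auto simp: complement_top_def)
  then show ?thesis
    by (rule torus_loops_commute)
       (simp_all add: F_def keyhole_loop_def keyhole_ends[OF d(2)])
qed

text \<open>
  A radius for which the errors are dominated at all of the finitely many hyperplanes.
\<close>
lemma keyhole_loops_commute:
  assumes comp: "compatible_shifts S v w" and v: "v \<in> complement A" and XY: "X \<in> S" "Y \<in> S"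
  shows "\<forall>\<^sub>F d in at_right 0. loop_homotopic (complement_top A) v
    (concat_loops (keyhole_loop d v (w X)) (keyhole_loop d v (w Y)))
    (concat_loops (keyhole_loop d v (w Y)) (keyhole_loop d v (w X)))"
proof -
  have "\<forall>H\<in>A. \<exists>h. Re (h * lin H v) > 0 \<and> (\<forall>X\<in>S. \<not> X \<subseteq> H \<longrightarrow> Re (h * lin H (w X)) \<le> 0)"
    using comp by (simp add: compatible_shifts_def)
  from bchoice[OF this] obtain h where
    h: "\<forall>H\<in>A. Re (h H * lin H v) > 0 \<and> (\<forall>X\<in>S. \<not> X \<subseteq> H \<longrightarrow> Re (h H * lin H (w X)) \<le> 0)"
    by (elim exE)
  let ?small = "\<lambda>d H. 2 * d * (norm (h H * lin H (w X)) + norm (h H * lin H (w Y))) < Re (h H * lin H v)"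
  have "\<forall>\<^sub>F d in at_right 0. \<forall>H\<in>A. ?small d H"
  proof (intro eventually_ball_finite finite_A ballI)
    fix H assume "H \<in> A"
    have "((\<lambda>d::real. 2 * d * (norm (h H * lin H (w X)) + norm (h H * lin H (w Y)))) \<longlongrightarrow>
        2 * 0 * (norm (h H * lin H (w X)) + norm (h H * lin H (w Y)))) (at_right 0)"
      by (intro tendsto_intros)
    then show "\<forall>\<^sub>F d in at_right 0. ?small d H"
      using h \<open>H \<in> A\<close> by (intro order_tendstoD(2)) auto
  qed
  moreover have "\<forall>\<^sub>F d in at_right 0. d \<in> {0<..<1::real}"
    by (rule eventually_at_right_real) simp
  ultimately show ?thesis
  proof eventually_elim
    case (elim d)
    then have d: "0 < d" "d \<le> 1" by auto
    have h1: "Re (h H * lin H v) > 0" if "H \<in> A" for H using h that by simp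
    have h2: "Re (h H * lin H (w Z)) \<le> 0" if "H \<in> A" "Z \<in> S" "\<not> Z \<subseteq> H" for H Z
      using h that by simp
    have sm: "?small d H" if "H \<in> A" for H using elim(1) that by simp
    have sm': "2 * d * (norm (h H * lin H (w Y)) + norm (h H * lin H (w X))) < Re (h H * lin H v)"
      if "H \<in> A" for H using sm[OF that] by (simp only: add.commute)
    consider "Y \<subseteq> X" | "X \<subseteq> Y" | "\<not> X \<subseteq> Y" "\<not> Y \<subseteq> X" by auto
    then show ?case
    proof cases
      case 1
      show ?thesis by (rule comparable_keyhole_loops_commute[OF comp v XY 1 d h1 h2 sm])
    next
      case 2
      show ?thesis
        by (rule loop_homotopic_sym,
            rule comparable_keyhole_loops_commute[OF comp v XY(2,1) 2 d h1 h2 sm'])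
    next
      case 3
      show ?thesis by (rule incomparable_keyhole_loops_commute[OF comp v XY 3 d h1 h2 sm])
    qed
  qed
qed

end

section \<open>Winding numbers\<close>

text \<open>
  Meant for a continuous map \<open>k\<close> into the nonzero complex numbers, when homotopy
  invariance makes the value independent of the chosen loop.
\<close>
definition class_winding :: "('a \<Rightarrow> complex) \<Rightarrow> (real \<Rightarrow> 'a) set \<Rightarrow> complex" where
  "class_winding k P = winding_number (k \<circ> (SOME g. g \<in> P)) 0"

lemma nonzero_loop:
  assumes "loopin X a g" "continuous_map X (top_of_set (- {0})) k"
  shows "path (k \<circ> g)" "0 \<notin> path_image (k \<circ> g)" "pathstart (k \<circ> g) = k a" "pathfinish (k \<circ> g) = k a"
proof -
  have "continuous_map (top_of_set {0..1}) X g"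
    using assms(1) by (simp add: loopin_def pathin_def)
  then have "continuous_map (top_of_set {0..1}) (top_of_set (- {0})) (k \<circ> g)"
    using assms(2) by (rule continuous_map_compose)
  then have "continuous_on {0..1} (k \<circ> g)" "(k \<circ> g) ` {0..1} \<subseteq> - {0}"
    by (simp_all only: continuous_map_subtopology_eu image_subset_iff_funcset)
  then show "path (k \<circ> g)" "0 \<notin> path_image (k \<circ> g)"
    unfolding path_def path_image_def by auto
  show "pathstart (k \<circ> g) = k a" "pathfinish (k \<circ> g) = k a"
    using assms(1) by (simp_all add: loopin_def pathstart_def pathfinish_def)
qed

lemma class_winding_loop_class:
  assumes g: "loopin X a g" and k: "continuous_map X (top_of_set (- {0})) k"
  shows "class_winding k (loop_class X a g) = winding_number (k \<circ> g) 0"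
proof -
  define f where "f = (SOME f. f \<in> loop_class X a g)"
  have "f \<in> loop_class X a g"
    unfolding f_def using in_own_loop_class[OF g] by (rule someI[where P = "\<lambda>f. f \<in> loop_class X a g"])
  then have gf: "loop_homotopic X a g f" by (simp add: loop_class_def)
  have "loop_homotopic (top_of_set (- {0})) (k a) (k \<circ> g) (k \<circ> f)"
    by (rule loop_homotopic_compose[OF gf k refl])
  then have "homotopic_paths (- {0}) (k \<circ> g) (k \<circ> f)"
    unfolding homotopic_paths_def loop_homotopic_def nonzero_loop(3,4)[OF g k]
    unfolding pathstart_def pathfinish_def .
  then show ?thesis
    unfolding class_winding_def f_def[symmetric] by (rule winding_number_homotopic_paths[symmetric])
qed

text \<open>
  So a map to \<open>\<complex> - {0}\<close> turns winding numbers into an additive function on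
  the fundamental group.
\<close>
lemma class_winding_mult:
  assumes "P \<in> carrier (fundamental_group X a)" "Q \<in> carrier (fundamental_group X a)"
    and k: "continuous_map X (top_of_set (- {0})) k"
  shows "class_winding k (P \<otimes>\<^bsub>fundamental_group X a\<^esub> Q) = class_winding k P + class_winding k Q"
proof -
  obtain f where f: "P = loop_class X a f" "loopin X a f"
    using assms(1) by (auto simp: carrier_fundamental_group)
  obtain g where g: "Q = loop_class X a g" "loopin X a g"
    using assms(2) by (auto simp: carrier_fundamental_group)
  have "k \<circ> concat_loops f g = (k \<circ> f) +++ (k \<circ> g)"
    by (rule ext) (simp add: concat_loops_def joinpaths_def)
  moreover have "pathfinish (k \<circ> f) = pathstart (k \<circ> g)"
    using nonzero_loop(4)[OF f(2) k] nonzero_loop(3)[OF g(2) k] by simp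
  ultimately have "winding_number (k \<circ> concat_loops f g) 0 = winding_number (k \<circ> f) 0 + winding_number (k \<circ> g) 0"
    using winding_number_join[OF nonzero_loop(1,2)[OF f(2) k] nonzero_loop(1,2)[OF g(2) k]]
    by (simp only:)
  then show ?thesis
    by (simp add: f g mult_fundamental_group class_winding_loop_class[OF _ k] loopin_concat)
qed

context central_arrangement
begin

text \<open>
  A quotient of two linear forms is homogeneous of degree 0, hence a function on orbits.
\<close>
definition form_ratio :: "(complex^'n) set \<Rightarrow> (complex^'n) set \<Rightarrow> (complex^'n) set \<Rightarrow> complex" where
  "form_ratio H K P = lin H (SOME x. x \<in> P) / lin K (SOME x. x \<in> P)"

lemma form_ratio_hopf:
  assumes "x \<in> complement A" "K \<in> A"
  shows "form_ratio H K (hopf x) = lin H x / lin K x"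
proof -
  have "1 *s x \<in> hopf x" unfolding hopf_def by (intro CollectI exI[of _ 1]) auto
  then have "(SOME y. y \<in> hopf x) \<in> hopf x" by (rule someI[where P = "\<lambda>y. y \<in> hopf x"])
  then obtain c where "c \<noteq> 0" "(SOME y. y \<in> hopf x) = c *s x" by (auto simp: hopf_def)
  then show ?thesis by (simp add: form_ratio_def form_scale)
qed

lemma continuous_map_form_ratio:
  assumes H: "H \<in> A" and K: "K \<in> A"
  shows "continuous_map (proj_complement_top A) (top_of_set (- {0})) (form_ratio H K)"
proof (rule continuous_compose_quotient_map[OF quotient_map_hopf])
  have nz: "lin H x \<noteq> 0" "lin K x \<noteq> 0" if "x \<in> complement A" for x
    using that H K by (auto simp: mem_complement)
  have "continuous_on (complement A) (\<lambda>x. lin H x / lin K x)"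
    using nz by (intro continuous_intros) auto
  then have "continuous_map (complement_top A) (top_of_set (- {0})) (\<lambda>x. lin H x / lin K x)"
    unfolding complement_top_def using nz by auto
  then show "continuous_map (complement_top A) (top_of_set (- {0})) (form_ratio H K \<circ> hopf)"
    by (rule continuous_map_eq) (simp add: complement_top_def form_ratio_hopf[OF _ K])
qed

text \<open>
  An explicit logarithm: on a hyperplane containing \<open>X\<close> the form is the keyhole times
  a constant, and on the others it remains in a half plane, where a branch of the logarithm is
  available. The radius is small to guarantee the latter.
\<close>
lemma lin_keyhole_loop_log:
  assumes comp: "compatible_shifts S v w" and v: "v \<in> complement A" and X: "X \<in> S" and H: "H \<in> A"
  shows "\<forall>\<^sub>F d in at_right 0. \<exists>q. continuous_on {0..1} q \<and>
    (\<forall>t\<in>{0..1}. exp (q t) = lin H (keyhole_loop d v (w X) t)) \<and>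
    q 1 - q 0 = (if X \<subseteq> H then 2 * of_real pi * \<i> else 0)"
proof (cases "X \<subseteq> H")
  case True
  have lw: "lin H (w X) = lin H v" by (rule compatible_shift_lin[OF comp X H True])
  have lv: "lin H v \<noteq> 0" using v H by (simp add: mem_complement)
  have "\<forall>\<^sub>F d in at_right 0. d \<in> {0<..<1::real}"
    by (rule eventually_at_right_real) simp
  then show ?thesis
  proof eventually_elim
    case (elim d)
    then have d: "0 < d" "d \<le> 1" by auto
    define q where "q t = of_real (ln (keyhole_radius d t)) + 2 * of_real pi * \<i> * of_real (keyhole_angle t)
        + Ln (lin H v)" for t
    have "continuous_on {0..1} q"
      unfolding q_def using keyhole_radius_pos[OF d(1)]
      by (intro continuous_intros continuous_on_keyhole_radius continuous_on_keyhole_angle)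
         (auto simp: less_imp_neq[THEN not_sym])
    moreover have "exp (q t) = lin H (keyhole_loop d v (w X) t)" for t
    proof -
      have "exp (of_real (ln (keyhole_radius d t)) :: complex) = of_real (keyhole_radius d t)"
        using keyhole_radius_pos[OF d(1), of t] by (simp add: exp_of_real)
      then have "exp (q t) = keyhole d t * lin H v"
        using lv by (simp add: q_def exp_add keyhole_def)
      then show ?thesis
        by (simp only: keyhole_loop_def form_diff form_scale lw) (simp add: algebra_simps)
    qed
    moreover have "q 1 - q 0 = 2 * of_real pi * \<i>"
      using d by (simp add: q_def keyhole_radius_def keyhole_angle_def)
    ultimately show ?case using True by (intro exI[of _ q]) simp
  qed
next
  case False
  obtain h where h: "Re (h * lin H v) > 0" "\<forall>X\<in>S. \<not> X \<subseteq> H \<longrightarrow> Re (h * lin H (w X)) \<le> 0"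
    using comp H unfolding compatible_shifts_def by auto
  have "((\<lambda>d::real. 2 * d * norm (h * lin H (w X))) \<longlongrightarrow> 2 * 0 * norm (h * lin H (w X))) (at_right 0)"
    by (intro tendsto_intros)
  then have "\<forall>\<^sub>F d in at_right 0. 2 * d * norm (h * lin H (w X)) < Re (h * lin H v)"
    by (rule order_tendstoD(2)) (use h in simp)
  moreover have "\<forall>\<^sub>F d in at_right 0. d \<in> {0<..<1::real}"
    by (rule eventually_at_right_real) simp
  ultimately show ?thesis
  proof eventually_elim
    case (elim d)
    then have d: "0 < d" "d \<le> 1" by auto
    let ?g = "\<lambda>t. lin H (keyhole_loop d v (w X) t)"
    define q where "q t = Ln (h * ?g t) - Ln h" for t
    have h0: "h \<noteq> 0" using h(1) by auto
    have pos: "Re (h * ?g t) > 0" if t: "t \<in> {0..1}" for t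
    proof -
      have "nearly_nonneg (2 * d) (1 - keyhole d t)"
        using nearly_nonneg_mono[OF keyhole_nearly_nonneg[OF d t], of "2 * d"] d by simp
      moreover have "Re (h * lin H (w X)) \<le> 0" using h(2) X False by simp
      ultimately have "Re (h * (lin H v - (1 - keyhole d t) * lin H (w X))) > 0"
        using half_plane_nonzero1(2)[OF h(1) _ _ d(1) elim(1)] by blast
      then show ?thesis by (simp only: keyhole_loop_def form_diff form_scale)
    qed
    have "continuous_on {0..1} q"
      unfolding q_def keyhole_loop_def
    proof (intro continuous_intros)
      fix t :: real assume "t \<in> {0..1}"
      from pos[OF this] show "h * lin H (v - (1 - keyhole d t) *s w X) \<notin> \<real>\<^sub>\<le>\<^sub>0"
        unfolding keyhole_loop_def complex_nonpos_Reals_iff by linarith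
    qed
    moreover have "exp (q t) = ?g t" if "t \<in> {0..1}" for t
    proof -
      have "h * ?g t \<noteq> 0"
      proof
        assume "h * ?g t = 0"
        with pos[OF that] show False by (simp only: zero_complex.simps)
      qed
      then show ?thesis using h0 unfolding q_def exp_diff by simp
    qed
    moreover have "q 1 - q 0 = 0"
      by (simp add: q_def keyhole_loop_def keyhole_ends[OF d(2)])
    ultimately show ?case using False by (intro exI[of _ q]) simp
  qed
qed

text \<open>
  The loop around \<open>X\<close> is counted by the form of \<open>H\<close> exactly if
  \<open>H\<close> contains \<open>X\<close>, and the form in the denominator contributes nothing.
\<close>
lemma winding_keyhole_loop:
  assumes comp: "compatible_shifts S v w" and v: "v \<in> complement A"
    and X: "X \<in> S" and H: "H \<in> A" and K: "K \<in> A" "\<not> X \<subseteq> K"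
  shows "\<forall>\<^sub>F d in at_right 0. loopin (complement_top A) v (keyhole_loop d v (w X)) \<longrightarrow>
    winding_number (form_ratio H K \<circ> (hopf \<circ> keyhole_loop d v (w X))) 0 = (if X \<subseteq> H then 1 else 0)"
  using lin_keyhole_loop_log[OF comp v X H] lin_keyhole_loop_log[OF comp v X K(1)]
proof eventually_elim
  case (elim d)
  let ?g = "keyhole_loop d v (w X)"
  obtain q where q: "continuous_on {0..1} q" "\<forall>t\<in>{0..1}. exp (q t) = lin H (?g t)"
    "q 1 - q 0 = (if X \<subseteq> H then 2 * of_real pi * \<i> else 0)"
    using elim(1) by (elim exE conjE)
  obtain r where r: "continuous_on {0..1} r" "\<forall>t\<in>{0..1}. exp (r t) = lin K (?g t)" "r 1 - r 0 = 0"
    using elim(2) unfolding if_not_P[OF K(2)] by (elim exE conjE)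
  show ?case
  proof
    assume g: "loopin (complement_top A) v ?g"
    have gA: "?g t \<in> complement A" if "t \<in> {0..1}" for t
      using g that by (auto simp: loopin_def pathin_def complement_top_def)
    define p where "p t = q t - r t" for t
    have p: "path p" unfolding path_def p_def using q(1) r(1) by (intro continuous_intros)
    have "winding_number (form_ratio H K \<circ> (hopf \<circ> ?g)) 0 = winding_number (exp \<circ> p) 0"
    proof (rule winding_number_cong)
      fix t :: real assume "0 \<le> t" "t \<le> 1"
      then have t: "t \<in> {0..1}" by simp
      show "(form_ratio H K \<circ> (hopf \<circ> ?g)) t = (exp \<circ> p) t"
        using form_ratio_hopf[OF gA[OF t] K(1)] q(2) r(2) t
        by (simp add: p_def exp_diff)
    qed
    also have "\<dots> = (p 1 - p 0) / (2 * of_real pi * \<i>)"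
      using winding_number_compose_exp[OF p] by (simp add: pathfinish_def pathstart_def)
    also have "p 1 - p 0 = (q 1 - q 0) - (r 1 - r 0)" by (simp add: p_def)
    also have "\<dots> = (if X \<subseteq> H then 2 * of_real pi * \<i> else 0)" using q(3) r(3) by simp
    also have "(if X \<subseteq> H then 2 * of_real pi * \<i> else 0) / (2 * of_real pi * \<i>) =
        (if X \<subseteq> H then 1 else 0 :: complex)" by simp
    finally show "winding_number (form_ratio H K \<circ> (hopf \<circ> ?g)) 0 = (if X \<subseteq> H then 1 else 0)" .
  qed
qed

end

section \<open>Nested sets\<close>

text \<open>
  Flats are ordered by reverse inclusion, so these are the maximal elements in the lattice.
\<close>
definition minimal_members :: "'a set set \<Rightarrow> 'a set set" where
  "minimal_members D = {Y \<in> D. \<forall>W\<in>D. W \<subseteq> Y \<longrightarrow> W = Y}"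

lemma minimal_members_subset: "minimal_members D \<subseteq> D"
  by (auto simp: minimal_members_def)

lemma minimal_member_below:
  assumes "finite D" "Z \<in> D"
  obtains Y where "Y \<in> minimal_members D" "Y \<subseteq> Z"
proof -
  obtain Y where Y: "Y \<in> D" "Y \<subseteq> Z" "\<forall>W\<in>D. W \<subseteq> Y \<longrightarrow> Y = W"
    using finite_has_minimal2[OF assms] by auto
  show thesis
  proof (rule that)
    show "Y \<in> minimal_members D" unfolding minimal_members_def using Y by auto
  qed fact
qed

lemma minimal_members_antichain:
  "\<forall>X\<in>minimal_members D. \<forall>Y\<in>minimal_members D. X \<subseteq> Y \<longrightarrow> X = Y"
  by (simp add: minimal_members_def)

lemma Inter_minimal_members:
  assumes "finite D" shows "\<Inter>(minimal_members D) = \<Inter>D"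
proof
  show "\<Inter>(minimal_members D) \<subseteq> \<Inter>D"
  proof (rule Inter_greatest)
    fix Z assume "Z \<in> D"
    then obtain Y where "Y \<in> minimal_members D" "Y \<subseteq> Z"
      by (rule minimal_member_below[OF assms])
    then show "\<Inter>(minimal_members D) \<subseteq> Z" by auto
  qed
  show "\<Inter>D \<subseteq> \<Inter>(minimal_members D)"
    by (rule Inter_anti_mono[OF minimal_members_subset])
qed

context central_arrangement
begin

lemma flat_eq_Inter: "X \<in> flats A \<Longrightarrow> \<Inter>{H \<in> A. X \<subseteq> H} = X"
  by (auto simp: mem_flat mem_hyperplane)

lemma UNIV_flat: "UNIV \<in> flats A"
  unfolding flats_def by (intro CollectI exI[of _ "{}"]) auto

lemma finite_flats: "finite (flats A)"
proof -
  have "flats A = Inter ` Pow A" by (auto simp: flats_def)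
  then show ?thesis using finite_A by simp
qed

lemma Inter_flat:
  assumes "T \<subseteq> flats A" shows "\<Inter>T \<in> flats A"
proof -
  have "\<Inter>T = \<Inter>{H \<in> A. \<exists>X\<in>T. X \<subseteq> H}"
  proof
    show "\<Inter>{H \<in> A. \<exists>X\<in>T. X \<subseteq> H} \<subseteq> \<Inter>T"
    proof (rule Inter_greatest)
      fix X assume X: "X \<in> T"
      then have "\<Inter>{H \<in> A. \<exists>X\<in>T. X \<subseteq> H} \<subseteq> \<Inter>{H \<in> A. X \<subseteq> H}" by auto
      also have "\<dots> = X" using X assms by (intro flat_eq_Inter) auto
      finally show "\<Inter>{H \<in> A. \<exists>X\<in>T. X \<subseteq> H} \<subseteq> X" .
    qed
  qed auto
  then show ?thesis unfolding flats_def by (intro CollectI exI[of _ "{H \<in> A. \<exists>X\<in>T. X \<subseteq> H}"]) auto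
qed

lemma Int_flat: "X \<in> flats A \<Longrightarrow> Y \<in> flats A \<Longrightarrow> X \<inter> Y \<in> flats A"
  using Inter_flat[of "{X, Y}"] by auto

lemma hyperplane_proper:
  assumes H: "H \<in> A" shows "H \<noteq> UNIV"
proof
  assume "H = UNIV"
  obtain i where i: "nf H $ i \<noteq> 0" using nf_nonzero[OF H] by (auto simp: vec_eq_iff)
  have "lin H (axis i 1) = nf H $ i"
    by (simp add: form_def axis_def if_distrib[of "\<lambda>x. _ * x"] cong: if_cong)
  moreover have "lin H (axis i 1) = 0" using mem_hyperplane[OF H] \<open>H = UNIV\<close> by auto
  ultimately show False using i by simp
qed

lemma hyperplane_subset_eq:
  assumes H: "H \<in> A" and K: "K \<in> A" and HK: "H \<subseteq> K" shows "H = K"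
proof (rule ccontr)
  assume "H \<noteq> K"
  then obtain x where x: "x \<in> K" "x \<notin> H" using HK by auto
  then have lx: "lin K x = 0" "lin H x \<noteq> 0" using mem_hyperplane H K by auto
  have "y \<in> K" for y
  proof -
    have "lin H (y - (lin H y / lin H x) *s x) = 0" using lx by (simp add: form_diff form_scale)
    then have "y - (lin H y / lin H x) *s x \<in> K" using HK mem_hyperplane[OF H] by auto
    then show ?thesis using mem_hyperplane[OF K] lx by (simp add: form_diff form_scale)
  qed
  then show False using hyperplane_proper[OF K] by auto
qed

lemma flat_above_hyperplane:
  assumes H: "H \<in> A" and X: "X \<in> flats A" and HX: "H \<subseteq> X" and "X \<noteq> UNIV"
  shows "X = H"
proof -
  obtain B where B: "B \<subseteq> A" "X = \<Inter>B" using X by (auto simp: flats_def)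
  then obtain K where K: "K \<in> B" using \<open>X \<noteq> UNIV\<close> by auto
  then have "H \<subseteq> K" using HX B(2) by auto
  then have "H = K" using hyperplane_subset_eq[OF H] K B(1) by auto
  then show ?thesis using K B(2) HX by auto
qed

lemma building_flat: "building_set A G \<Longrightarrow> X \<in> G \<Longrightarrow> X \<in> flats A"
  and building_proper: "building_set A G \<Longrightarrow> X \<in> G \<Longrightarrow> X \<noteq> UNIV"
  by (auto simp: building_set_def)

lemma factor_flat: "building_set A G \<Longrightarrow> Y \<in> building_factors G Z \<Longrightarrow> Y \<in> flats A"
  by (auto simp: building_factors_def intro: building_flat)

text \<open>
  Injectivity of the join map, without reference to extensional functions.
\<close>
lemma building_tuple_eq:
  assumes G: "building_set A G" and Z: "Z \<in> flats A" "Z \<noteq> UNIV"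
    and f: "\<And>Y. Y \<in> building_factors G Z \<Longrightarrow> f Y \<in> flats A \<and> Y \<subseteq> f Y"
    and g: "\<And>Y. Y \<in> building_factors G Z \<Longrightarrow> g Y \<in> flats A \<and> Y \<subseteq> g Y"
    and eq: "(\<Inter>Y\<in>building_factors G Z. f Y) = (\<Inter>Y\<in>building_factors G Z. g Y)"
    and Y: "Y \<in> building_factors G Z"
  shows "f Y = g Y"
proof -
  let ?F = "building_factors G Z"
  let ?P = "\<Pi>\<^sub>E Y\<in>?F. lower_interval A Y"
  have inj: "inj_on (\<lambda>f. \<Inter>Y\<in>?F. f Y) ?P"
    using G Z unfolding building_set_def poset_iso_def bij_betw_def by auto
  have "restrict f ?F = restrict g ?F"
  proof (rule inj_onD[OF inj])
    show "restrict f ?F \<in> ?P" "restrict g ?F \<in> ?P" using f g by (auto simp: lower_interval_def)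
    show "(\<Inter>Y\<in>?F. restrict f ?F Y) = (\<Inter>Y\<in>?F. restrict g ?F Y)"
      using eq by (simp cong: INF_cong)
  qed
  then show ?thesis using Y by (metis restrict_apply')
qed

text \<open>
  Surjectivity of the join map, without reference to extensional functions.
\<close>
lemma building_tuple_exists:
  assumes G: "building_set A G" and Z: "Z \<in> flats A" "Z \<noteq> UNIV" and W: "W \<in> flats A" "Z \<subseteq> W"
  shows "\<exists>f. (\<forall>Y\<in>building_factors G Z. f Y \<in> flats A \<and> Y \<subseteq> f Y) \<and>
    W = (\<Inter>Y\<in>building_factors G Z. f Y)"
proof -
  let ?F = "building_factors G Z"
  let ?P = "\<Pi>\<^sub>E Y\<in>?F. lower_interval A Y"
  have "(\<lambda>f. \<Inter>Y\<in>?F. f Y) ` ?P = lower_interval A Z"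
    using G Z unfolding building_set_def poset_iso_def bij_betw_def by auto
  moreover have "W \<in> lower_interval A Z" using W by (simp add: lower_interval_def)
  ultimately have "W \<in> (\<lambda>f. \<Inter>Y\<in>?F. f Y) ` ?P" by (simp only:)
  then obtain f where f: "W = (\<Inter>Y\<in>?F. f Y)" "f \<in> ?P" by (rule imageE)
  have "\<forall>Y\<in>?F. f Y \<in> flats A \<and> Y \<subseteq> f Y"
    using f(2) by (auto simp: lower_interval_def dest: PiE_mem)
  with f(1) show ?thesis by (intro exI[of _ f] conjI)
qed

lemma factor_exists:
  assumes G: "building_set A G" and Y: "Y \<in> G" "Z \<subseteq> Y"
  obtains g where "g \<in> building_factors G Z" "g \<subseteq> Y"
proof -
  have "G \<subseteq> flats A" using building_flat[OF G] by auto
  then have "finite {W \<in> G. Z \<subseteq> W}" by (intro finite_subset[OF _ finite_flats]) auto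
  moreover have "Y \<in> {W \<in> G. Z \<subseteq> W}" using Y by simp
  ultimately obtain g where g: "g \<in> minimal_members {W \<in> G. Z \<subseteq> W}" "g \<subseteq> Y"
    by (rule minimal_member_below)
  show thesis
    by (rule that[OF _ g(2)]) (use g(1) in \<open>simp add: minimal_members_def building_factors_def\<close>)
qed

lemma Inter_factors:
  assumes G: "building_set A G" and Z: "Z \<in> flats A" "Z \<noteq> UNIV"
  shows "\<Inter>(building_factors G Z) = Z"
proof
  obtain f where f: "\<forall>Y\<in>building_factors G Z. f Y \<in> flats A \<and> Y \<subseteq> f Y"
    and Zf: "Z = (\<Inter>Y\<in>building_factors G Z. f Y)"
    using building_tuple_exists[OF G Z Z(1) subset_refl] by (elim exE conjE)
  have "\<Inter>(building_factors G Z) \<subseteq> (\<Inter>Y\<in>building_factors G Z. f Y)"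
    using f by blast
  then show "\<Inter>(building_factors G Z) \<subseteq> Z" using Zf by (simp only:)
qed (auto simp: building_factors_def)

text \<open>
  A flat \<open>Y\<close> below two different factors would be the join of two different tuples:
  \<open>Y\<close> in one place and the bottom element elsewhere.
\<close>
lemma factors_disjoint:
  assumes G: "building_set A G" and Z: "Z \<in> flats A" "Z \<noteq> UNIV"
    and g: "g \<in> building_factors G Z" "g' \<in> building_factors G Z" "g \<noteq> g'"
    and Y: "Y \<in> flats A" "g \<subseteq> Y" "g' \<subseteq> Y"
  shows "Y = UNIV"
proof -
  let ?f = "\<lambda>k X. if X = k then Y else UNIV"
  have "(\<Inter>X\<in>building_factors G Z. ?f k X) = Y" if "k \<in> building_factors G Z" for k
  proof
    show "(\<Inter>X\<in>building_factors G Z. ?f k X) \<subseteq> Y"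
      using INF_lower[OF that, of "?f k"] by simp
    show "Y \<subseteq> (\<Inter>X\<in>building_factors G Z. ?f k X)"
      by (rule INF_greatest) simp
  qed
  note eq = this[OF g(1)] this[OF g(2)]
  have "?f g g = ?f g' g"
  proof (rule building_tuple_eq[OF G Z, of "?f g" "?f g'" g])
    show "(\<Inter>X\<in>building_factors G Z. ?f g X) = (\<Inter>X\<in>building_factors G Z. ?f g' X)"
      by (rule trans[OF eq(1) eq(2)[symmetric]])
  qed (use g Y UNIV_flat in \<open>simp_all\<close>)
  then show ?thesis using g(3) by simp
qed

text \<open>
  The decisive property of nested sets: the elements of an antichain are the factors of their
  join, so all of the product decomposition becomes available for it. For a factor
  \<open>g\<close>, the elements of \<open>T\<close> below \<open>g\<close> have join
  \<open>g\<close>, by uniqueness of the decomposition of the join of \<open>T\<close>. As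
  \<open>g\<close> is in the building set, nestedness allows only one such element, which is then
  \<open>g\<close> itself.
\<close>
lemma antichain_factors:
  assumes G: "building_set A G" and S: "nested G S" and T: "T \<subseteq> S" "T \<noteq> {}"
    and anti: "\<forall>X\<in>T. \<forall>Y\<in>T. X \<subseteq> Y \<longrightarrow> X = Y"
  shows "\<Inter>T \<in> flats A" "\<Inter>T \<noteq> UNIV" "building_factors G (\<Inter>T) = T"
proof -
  have TG: "T \<subseteq> G" using S T by (auto simp: nested_def)
  have Tf: "T \<subseteq> flats A" using TG building_flat[OF G] by auto
  show Z1: "\<Inter>T \<in> flats A" by (rule Inter_flat[OF Tf])
  show Z2: "\<Inter>T \<noteq> UNIV" using T(2) TG building_proper[OF G] by auto
  let ?F = "building_factors G (\<Inter>T)"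
  have below: "\<exists>g\<in>?F. g \<subseteq> Y" if "Y \<in> T" for Y
  proof -
    have "Y \<in> G" "\<Inter>T \<subseteq> Y" using that TG by auto
    then obtain g where "g \<in> ?F" "g \<subseteq> Y" by (rule factor_exists[OF G])
    then show ?thesis by auto
  qed
  have FT: "g \<in> T" if g: "g \<in> ?F" for g
  proof -
    let ?T = "\<lambda>g. {Y \<in> T. g \<subseteq> Y}"
    have gG: "g \<in> G" using g by (simp add: building_factors_def)
    have "\<Inter>(?T g) = g"
    proof (rule building_tuple_eq[OF G Z1 Z2 _ _ _ g, of "\<lambda>g. \<Inter>(?T g)" "\<lambda>g. g"])
      show "\<Inter>(?T Y) \<in> flats A \<and> Y \<subseteq> \<Inter>(?T Y)" for Y
        using Tf by (auto intro!: Inter_flat)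
      show "Y \<in> flats A \<and> Y \<subseteq> Y" if "Y \<in> ?F" for Y using factor_flat[OF G that] by simp
      have "(\<Inter>Y\<in>?F. \<Inter>(?T Y)) = \<Inter>T"
      proof
        show "(\<Inter>Y\<in>?F. \<Inter>(?T Y)) \<subseteq> \<Inter>T" using below by blast
      qed blast
      then show "(\<Inter>Y\<in>?F. \<Inter>(?T Y)) = (\<Inter>Y\<in>?F. Y)"
        by (simp only: image_ident Inter_factors[OF G Z1 Z2])
    qed
    have "\<not> 2 \<le> card (?T g)"
    proof
      assume "2 \<le> card (?T g)"
      moreover have "?T g \<subseteq> S" using T by auto
      moreover have "\<forall>X\<in>?T g. \<forall>Y\<in>?T g. X \<noteq> Y \<longrightarrow> \<not> Y \<subseteq> X \<and> \<not> X \<subseteq> Y"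
        using anti by auto
      ultimately have "\<Inter>(?T g) \<notin> G" using S unfolding nested_def by blast
      then show False using \<open>\<Inter>(?T g) = g\<close> gG by simp
    qed
    moreover have "finite (?T g)" using Tf by (intro finite_subset[OF _ finite_flats]) auto
    moreover have "?T g \<noteq> {}"
    proof
      assume "?T g = {}"
      then have "\<Inter>(?T g) = UNIV" by (simp only: Inter_empty)
      then show False using \<open>\<Inter>(?T g) = g\<close> building_proper[OF G gG] by simp
    qed
    ultimately have "card (?T g) \<noteq> 0" "\<not> 2 \<le> card (?T g)" by simp_all
    then have "card (?T g) = 1" by linarith
    then obtain Y where Y: "?T g = {Y}" by (auto simp: card_1_singleton_iff)
    then have "Y = g" using \<open>\<Inter>(?T g) = g\<close> by simp
    then show "g \<in> T" using Y by auto
  qed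
  show "?F = T"
  proof
    show "T \<subseteq> ?F"
    proof
      fix Y assume Y: "Y \<in> T"
      obtain g where g: "g \<in> ?F" "g \<subseteq> Y" using below[OF Y] by auto
      then show "Y \<in> ?F" using anti FT[OF g(1)] Y g by auto
    qed
  qed (use FT in auto)
qed

text \<open>
  If they were incomparable, the two flats would be different factors of their join with
  \<open>H\<close> below both.
\<close>
lemma nested_comparable:
  assumes G: "building_set A G" and S: "nested G S" and XZ: "X \<in> S" "Z \<in> S"
    and H: "H \<in> A" "X \<subseteq> H" "Z \<subseteq> H"
  shows "X \<subseteq> Z \<or> Z \<subseteq> X"
proof (rule ccontr)
  assume n: "\<not> (X \<subseteq> Z \<or> Z \<subseteq> X)"
  have anti: "\<forall>U\<in>{X, Z}. \<forall>W\<in>{X, Z}. U \<subseteq> W \<longrightarrow> U = W"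
    using n by auto
  have T: "{X, Z} \<subseteq> S" "{X, Z} \<noteq> {}" using XZ by auto
  note F = antichain_factors[OF G S T anti]
  have "H = UNIV"
    by (rule factors_disjoint[OF G F(1,2), of X Z]) (use F n H hyperplane_flat in auto)
  then show False using hyperplane_proper H by auto
qed

text \<open>
  In the order of the lattice the elements of \<open>S\<close> above the hyperplane
  \<open>H\<close> form a chain, to which the origin is added as the top; \<open>M\<close> is the
  least element of this chain. The origin takes this role for a hyperplane that is below no
  element of \<open>S\<close>.
\<close>
definition least_above ::
  "(complex^'n) set set \<Rightarrow> (complex^'n) set \<Rightarrow> (complex^'n) set \<Rightarrow> bool" where
  "least_above S H M \<longleftrightarrow> M \<in> insert {0} S \<and> M \<subseteq> H \<and> (\<forall>Z\<in>S. Z \<subseteq> H \<longrightarrow> Z \<subseteq> M)"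

lemma nested_flat: "building_set A G \<Longrightarrow> nested G S \<Longrightarrow> X \<in> S \<Longrightarrow> X \<in> flats A"
  by (auto simp: nested_def intro: building_flat)

lemma finite_nested:
  assumes "building_set A G" "nested G S" shows "finite S"
  using nested_flat[OF assms] by (intro finite_subset[OF _ finite_flats]) auto

lemma least_above_exists:
  assumes G: "building_set A G" and S: "nested G S" and H: "H \<in> A"
  obtains M where "least_above S H M"
proof -
  let ?C = "{Z \<in> insert {0} S. Z \<subseteq> H}"
  have "{0} \<in> ?C" using mem_hyperplane[OF H] by (simp add: form_zero)
  moreover have "finite ?C" using finite_nested[OF G S] by simp
  ultimately obtain M where M: "M \<in> ?C" "\<forall>Z\<in>?C. M \<subseteq> Z \<longrightarrow> M = Z"
    using finite_has_maximal[of ?C] by auto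
  have "Z \<subseteq> M" if Z: "Z \<in> S" "Z \<subseteq> H" for Z
  proof -
    have "M \<subseteq> Z \<or> Z \<subseteq> M"
    proof (cases "M \<in> S")
      case True
      then show ?thesis using nested_comparable[OF G S True Z(1) H _ Z(2)] M by auto
    next
      case False
      then have "M = {0}" using M by auto
      then show ?thesis using flat_zero[OF nested_flat[OF G S Z(1)]] by auto
    qed
    then show ?thesis using M(2) Z by auto
  qed
  then have "least_above S H M" using M(1) by (auto simp: least_above_def)
  then show thesis ..
qed

text \<open>
  The elements of \<open>S\<close> strictly below \<open>M\<close> do not join up to
  \<open>M\<close>: the maximal ones are the factors of their join, while \<open>M\<close> is its
  own only factor. A hyperplane below \<open>M\<close> but not below that join has the required
  property.
\<close>
lemma own_hyperplane:
  assumes G: "building_set A G" and S: "nested G S" and M: "M \<in> insert {0} S"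
  obtains H where "H \<in> A" "least_above S H M"
proof -
  have MG: "M \<in> G" using M G S by (auto simp: building_set_def nested_def)
  have Mf: "M \<in> flats A" by (rule building_flat[OF G MG])
  define D where "D = {Y \<in> S. M \<subset> Y}"
  define T where "T = minimal_members D"
  have finD: "finite D" unfolding D_def using finite_nested[OF G S] by simp
  have TD: "T \<subseteq> D" unfolding T_def by (rule minimal_members_subset)
  then have TS: "T \<subseteq> S" by (auto simp: D_def)
  have "\<Inter>T \<noteq> M"
  proof (cases "T = {}")
    case True
    then show ?thesis using building_proper[OF G MG] by auto
  next
    case False
    have anti: "\<forall>X\<in>T. \<forall>Y\<in>T. X \<subseteq> Y \<longrightarrow> X = Y"
      unfolding T_def by (rule minimal_members_antichain)
    have "building_factors G (\<Inter>T) = T"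
      by (rule antichain_factors(3)[OF G S TS False anti])
    moreover have "M \<in> building_factors G M" using MG by (simp add: building_factors_def)
    moreover have "M \<notin> T" using TD by (auto simp: D_def)
    ultimately show ?thesis by metis
  qed
  moreover have "M \<subseteq> \<Inter>T" using TD by (auto simp: D_def)
  ultimately have n: "\<not> \<Inter>T \<subseteq> M" using subset_antisym[of "\<Inter>T" M] by iprover
  have "\<exists>H\<in>A. M \<subseteq> H \<and> \<not> \<Inter>T \<subseteq> H"
  proof (rule ccontr)
    assume "\<not> (\<exists>H\<in>A. M \<subseteq> H \<and> \<not> \<Inter>T \<subseteq> H)"
    then have "\<Inter>T \<subseteq> \<Inter>{H \<in> A. M \<subseteq> H}" by (intro Inter_greatest) blast
    with n show False unfolding flat_eq_Inter[OF Mf] by (rule notE)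
  qed
  then obtain H where H: "H \<in> A" "M \<subseteq> H" "\<not> \<Inter>T \<subseteq> H" by (elim bexE conjE)
  have "Z \<subseteq> M" if Z: "Z \<in> S" "Z \<subseteq> H" for Z
  proof (rule ccontr)
    assume n: "\<not> Z \<subseteq> M"
    show False
    proof (cases "M \<subseteq> Z")
      case True
      then have "Z \<in> D" using n Z by (auto simp: D_def)
      then obtain Y where "Y \<in> T" "Y \<subseteq> Z" unfolding T_def by (rule minimal_member_below[OF finD])
      then show False using H(3) Z(2) by auto
    next
      case False
      then have "M \<noteq> {0}" using flat_zero[OF nested_flat[OF G S Z(1)]] by auto
      then have "M \<in> S" using M by simp
      then show False using nested_comparable[OF G S _ Z(1) H(1,2) Z(2)] n False by auto
    qed
  qed
  then have "least_above S H M" using H M by (auto simp: least_above_def)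
  with H(1) show thesis by (rule that)
qed

text \<open>
  The maximal elements of \<open>S\<close> not above \<open>M\<close> are the factors of their
  join. If \<open>H\<close> were below the join, then the tuple whose join is \<open>H\<close>
  would have \<open>H\<close> as an entry, because above a hyperplane there is no flat but itself
  and the whole space. So \<open>H\<close> would be below one of these elements, against the
  choice of \<open>M\<close>.
\<close>
lemma not_above_avoids_hyperplane:
  assumes G: "building_set A G" and S: "nested G S" and H: "H \<in> A" and M: "least_above S H M"
  shows "\<not> \<Inter>{Z \<in> S. \<not> Z \<subseteq> M} \<subseteq> H"
proof
  assume sub: "\<Inter>{Z \<in> S. \<not> Z \<subseteq> M} \<subseteq> H"
  define D where "D = {Z \<in> S. \<not> Z \<subseteq> M}"
  define T where "T = minimal_members D"
  have finD: "finite D" unfolding D_def using finite_nested[OF G S] by simp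
  have TD: "T \<subseteq> D" unfolding T_def by (rule minimal_members_subset)
  then have TS: "T \<subseteq> S" by (auto simp: D_def)
  have subT: "\<Inter>T \<subseteq> H"
    using sub unfolding T_def Inter_minimal_members[OF finD] unfolding D_def .
  have ne: "T \<noteq> {}" using subT hyperplane_proper[OF H] by auto
  have anti: "\<forall>X\<in>T. \<forall>Y\<in>T. X \<subseteq> Y \<longrightarrow> X = Y"
    unfolding T_def by (rule minimal_members_antichain)
  note F = antichain_factors[OF G S TS ne anti]
  obtain f where f: "\<forall>Y\<in>T. f Y \<in> flats A \<and> Y \<subseteq> f Y" "H = (\<Inter>Y\<in>T. f Y)"
    using building_tuple_exists[OF G F(1,2) hyperplane_flat[OF H] subT] unfolding F(3)
    by (elim exE conjE)
  have "\<exists>Y\<in>T. f Y \<noteq> UNIV"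
  proof (rule ccontr)
    assume "\<not> (\<exists>Y\<in>T. f Y \<noteq> UNIV)"
    then have "(\<Inter>Y\<in>T. f Y) = UNIV" by auto
    then show False using f(2) hyperplane_proper[OF H] by simp
  qed
  then obtain Y where Y: "Y \<in> T" "f Y \<noteq> UNIV" by auto
  have "H \<subseteq> f Y" unfolding f(2) using Y(1) by (rule INF_lower)
  then have "f Y = H"
    using f(1) Y(1) by (intro flat_above_hyperplane[OF H _ _ Y(2)]) simp_all
  then have "Y \<subseteq> H" using f(1) Y(1) by blast
  moreover have "Y \<in> D" using Y TD by auto
  ultimately show False using M by (auto simp: least_above_def D_def)
qed

text \<open>
  The flat \<open>X\<close> and the intersection of the flats incomparable to it together span the
  whole space. The hyperplanes through \<open>X\<close> are added one at a time: by uniqueness of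
  the product decomposition, each one that cuts down the intersection so far also cuts down its
  intersection with the incomparable flats, and a vector that witnesses this corrects the shift.
\<close>
lemma incomparable_complement:
  assumes G: "building_set A G" and S: "nested G S" and X: "X \<in> S"
  shows "\<exists>w. v - w \<in> X \<and> (\<forall>Y\<in>S. \<not> X \<subseteq> Y \<longrightarrow> \<not> Y \<subseteq> X \<longrightarrow> w \<in> Y)"
proof -
  define D where "D = {Y \<in> S. \<not> X \<subseteq> Y \<and> \<not> Y \<subseteq> X}"
  define T where "T = minimal_members D"
  have finD: "finite D" unfolding D_def using finite_nested[OF G S] by simp
  have TD: "T \<subseteq> D" unfolding T_def by (rule minimal_members_subset)
  have XT: "X \<notin> T" using TD by (auto simp: D_def)
  have Df: "D \<subseteq> flats A" using nested_flat[OF G S] by (auto simp: D_def)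
  have Xf: "X \<in> flats A" by (rule nested_flat[OF G S X])
  have If: "\<Inter>D \<in> flats A" by (rule Inter_flat[OF Df])
  have sub: "insert X T \<subseteq> S" "insert X T \<noteq> {}" using X TD by (auto simp: D_def)
  have antiT: "\<forall>X\<in>T. \<forall>Y\<in>T. X \<subseteq> Y \<longrightarrow> X = Y"
    unfolding T_def by (rule minimal_members_antichain)
  have "\<not> X \<subseteq> Y \<and> \<not> Y \<subseteq> X" if "Y \<in> T" for Y using that TD by (auto simp: D_def)
  with antiT have anti: "\<forall>U\<in>insert X T. \<forall>W\<in>insert X T. U \<subseteq> W \<longrightarrow> U = W"
    by (simp add: ball_simps)
  note F = antichain_factors[OF G S sub anti]
  have *: "\<forall>v. \<exists>w\<in>\<Inter>D. v - w \<in> \<Inter>B" if "finite B" "B \<subseteq> {H \<in> A. X \<subseteq> H}" for B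
    using that
  proof (induction B rule: finite_induct)
    case empty
    show ?case using flat_zero[OF If] by auto
  next
    case (insert H B)
    then have H: "H \<in> A" "X \<subseteq> H" and B: "B \<subseteq> A" "X \<subseteq> \<Inter>B" by auto
    have Bf: "\<Inter>B \<in> flats A" using B unfolding flats_def by auto
    have IH: "\<forall>v. \<exists>w\<in>\<Inter>D. v - w \<in> \<Inter>B" using insert by simp
    show ?case
    proof (cases "\<Inter>B \<subseteq> H")
      case True
      then have eq: "\<Inter>(insert H B) = \<Inter>B" by auto
      show ?thesis unfolding eq by (rule IH)
    next
      case False
      let ?f = "\<lambda>Z Y. if Y = X then Z else Y"
      have Int: "(\<Inter>Y\<in>insert X T. ?f Z Y) = Z \<inter> \<Inter>D" for Z
      proof -
        have "(\<Inter>Y\<in>T. ?f Z Y) = (\<Inter>Y\<in>T. Y)"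
          by (intro INF_cong refl) (use XT in auto)
        also have "\<dots> = \<Inter>D"
          unfolding T_def image_ident by (rule Inter_minimal_members[OF finD])
        finally show ?thesis by (simp only: INF_insert simp_thms if_True)
      qed
      have "\<Inter>B \<inter> \<Inter>D \<noteq> (H \<inter> \<Inter>B) \<inter> \<Inter>D"
      proof
        assume eq: "\<Inter>B \<inter> \<Inter>D = (H \<inter> \<Inter>B) \<inter> \<Inter>D"
        have "?f (\<Inter>B) X = ?f (H \<inter> \<Inter>B) X"
        proof (rule building_tuple_eq[OF G F(1,2), unfolded F(3), of "?f (\<Inter>B)" "?f (H \<inter> \<Inter>B)" X])
          show "?f (\<Inter>B) Y \<in> flats A \<and> Y \<subseteq> ?f (\<Inter>B) Y" if "Y \<in> insert X T" for Y
            using that Bf B(2) TD Df by auto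
          show "?f (H \<inter> \<Inter>B) Y \<in> flats A \<and> Y \<subseteq> ?f (H \<inter> \<Inter>B) Y" if "Y \<in> insert X T" for Y
            using that Bf B(2) TD Df H Int_flat[OF hyperplane_flat[OF H(1)] Bf] by auto
          show "(\<Inter>Y\<in>insert X T. ?f (\<Inter>B) Y) = (\<Inter>Y\<in>insert X T. ?f (H \<inter> \<Inter>B) Y)"
            unfolding Int by (rule eq)
        qed simp
        then show False using False by auto
      qed
      then obtain u where u: "u \<in> \<Inter>B" "u \<in> \<Inter>D" "u \<notin> H" by auto
      then have lu: "lin H u \<noteq> 0" using mem_hyperplane[OF H(1)] by simp
      show ?thesis
      proof
        fix v
        obtain w where w: "w \<in> \<Inter>D" "v - w \<in> \<Inter>B" using IH by (elim allE bexE)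
        define c where "c = lin H (v - w) / lin H u"
        have "(v - w) - c *s u \<in> \<Inter>B"
          by (intro flat_diff flat_smult Bf w u)
        moreover have "(v - w) - c *s u \<in> H"
          using mem_hyperplane[OF H(1)] lu by (simp add: form_diff form_scale c_def)
        moreover have "(v - w) - c *s u = v - (w + c *s u)" by simp
        ultimately have "v - (w + c *s u) \<in> \<Inter>(insert H B)" by simp
        moreover have "w + c *s u \<in> \<Inter>D"
          by (intro flat_add flat_smult If w u)
        ultimately show "\<exists>w\<in>\<Inter>D. v - w \<in> \<Inter>(insert H B)" by (rule bexI)
      qed
    qed
  qed
  have "finite {H \<in> A. X \<subseteq> H}" using finite_A by simp
  from *[OF this subset_refl] obtain w where w: "w \<in> \<Inter>D" "v - w \<in> \<Inter>{H \<in> A. X \<subseteq> H}"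
    by (elim allE bexE)
  show ?thesis
  proof (intro exI[of _ w] conjI ballI impI)
    show "v - w \<in> X" using w(2) unfolding flat_eq_Inter[OF Xf] .
    show "w \<in> Y" if "Y \<in> S" "\<not> X \<subseteq> Y" "\<not> Y \<subseteq> X" for Y
      using w(1) that by (auto simp: D_def)
  qed
qed

end

section \<open>Existence of compatible shifts\<close>

lemma dominant_power_eventually_nonpos:
  fixes c :: "'a \<Rightarrow> real" and k :: "'a \<Rightarrow> nat"
  assumes I: "finite I" "j \<in> I" and c: "c j < 0" and k: "0 < k j"
    and dom: "\<And>i. i \<in> I \<Longrightarrow> i \<noteq> j \<Longrightarrow> c i = 0 \<or> k i < k j"
  shows "\<forall>\<^sub>F R in at_top. c0 + (\<Sum>i\<in>I. R ^ k i * c i) \<le> 0"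
proof -
  have pow: "((\<lambda>R::real. R ^ m / R ^ k j) \<longlongrightarrow> 0) at_top" if "m < k j" for m
  proof -
    have "((\<lambda>R::real. inverse (R ^ (k j - m))) \<longlongrightarrow> 0) at_top"
      using that by (intro tendsto_inverse_0_at_top filterlim_pow_at_top filterlim_ident) simp
    moreover have "\<forall>\<^sub>F R in at_top. inverse (R ^ (k j - m)) = R ^ m / (R ^ k j :: real)"
      using eventually_gt_at_top[of 0]
    proof eventually_elim
      case (elim R)
      have "R ^ k j = R ^ m * R ^ (k j - m)" using that by (simp flip: power_add)
      then show ?case using elim by (simp add: field_simps)
    qed
    ultimately show ?thesis by (rule Lim_transform_eventually)
  qed
  have lim: "((\<lambda>R. c i * (R ^ k i / R ^ k j)) \<longlongrightarrow> (if i = j then c j else 0)) at_top" if i: "i \<in> I" for i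
  proof (cases "i = j")
    case True
    have "\<forall>\<^sub>F R in at_top. c j = c i * (R ^ k i / R ^ k j)"
      using eventually_gt_at_top[of 0] by eventually_elim (use True in simp)
    then show ?thesis using True by (auto intro: Lim_transform_eventually[OF tendsto_const])
  next
    case False
    then have "c i = 0 \<or> k i < k j" using dom i by simp
    then show ?thesis
    proof
      assume "k i < k j"
      from tendsto_mult_left[OF pow[OF this], of "c i"] show ?thesis using False by simp
    qed (use False in simp)
  qed
  have "((\<lambda>R. c0 * (R ^ 0 / R ^ k j) + (\<Sum>i\<in>I. c i * (R ^ k i / R ^ k j))) \<longlongrightarrow>
      c0 * 0 + (\<Sum>i\<in>I. if i = j then c j else 0)) at_top"
    by (intro tendsto_add tendsto_sum lim tendsto_mult_left pow k)
  then have "\<forall>\<^sub>F R in at_top. c0 * (R ^ 0 / R ^ k j) + (\<Sum>i\<in>I. c i * (R ^ k i / R ^ k j)) < 0"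
    by (rule order_tendstoD(2)) (use I c in simp)
  with eventually_gt_at_top[of 0] show ?thesis
  proof eventually_elim
    case (elim R)
    then have pos: "R ^ k j > 0" by simp
    have "c0 + (\<Sum>i\<in>I. R ^ k i * c i) =
        R ^ k j * (c0 * (R ^ 0 / R ^ k j) + (\<Sum>i\<in>I. c i * (R ^ k i / R ^ k j)))"
      using elim(1) by (simp add: distrib_left sum_distrib_left mult.commute)
    also have "\<dots> < 0" using elim(2) pos by (intro mult_pos_neg)
    finally show ?case by simp
  qed
qed

lemma finite_real_linear_roots:
  fixes a b :: real
  assumes "a \<noteq> 0 \<or> b \<noteq> 0"
  shows "finite {r. a + r * b = 0}"
proof (rule finite_subset)
  show "{r. a + r * b = 0} \<subseteq> {- a / b}"
  proof
    fix r assume "r \<in> {r. a + r * b = 0}"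
    then have r: "r * b = - a" by simp
    then have "b \<noteq> 0" using assms by auto
    then have "r = r * b / b" by simp
    then show "r \<in> {- a / b}" unfolding r singleton_iff .
  qed
qed simp

text \<open>
  If \<open>b / a\<close> is not real, some \<open>z\<close> with real part 1 turns it into a
  number with real part -1; then \<open>h = z / a\<close>.
\<close>
lemma separating_multiplier:
  fixes a b :: complex
  assumes "a \<noteq> 0" "Im (b / a) \<noteq> 0"
  obtains h where "Re (h * a) > 0" "Re (h * b) < 0"
proof -
  define q where "q = b / a"
  define h where "h = Complex 1 ((Re q + 1) / Im q) / a"
  have "h * a = Complex 1 ((Re q + 1) / Im q)" using assms(1) by (simp add: h_def)
  moreover have "h * b = Complex 1 ((Re q + 1) / Im q) * q" by (simp add: h_def q_def)
  ultimately have "Re (h * a) = 1" "Re (h * b) = -1"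
    using assms(2) by (simp_all add: q_def[symmetric] del: times_complex.sel) (simp add: times_complex.sel)
  then show thesis by (intro that[of h]) simp_all
qed

context central_arrangement
begin

lemma flat_sum: "X \<in> flats A \<Longrightarrow> (\<And>i. i \<in> I \<Longrightarrow> f i \<in> X) \<Longrightarrow> (\<Sum>i\<in>I. f i) \<in> X"
  by (induction I rule: infinite_finite_induct) (auto intro: flat_zero flat_add)

text \<open>
  A finite avoidance argument. The condition for a further hyperplane is met by adding a real
  multiple of a suitable vector; each condition excludes at most one multiple.
\<close>
lemma generic_vector:
  assumes v: "v \<in> complement A" and D: "D \<in> flats A"
  shows "\<exists>u\<in>D. \<forall>H\<in>A. \<not> D \<subseteq> H \<longrightarrow> Im (lin H u / lin H v) \<noteq> 0"
proof -
  have "\<exists>u\<in>D. \<forall>H\<in>B. \<not> D \<subseteq> H \<longrightarrow> Im (lin H u / lin H v) \<noteq> 0" if "finite B" "B \<subseteq> A" for B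
    using that
  proof (induction B rule: finite_induct)
    case empty
    show ?case using flat_zero[OF D] by auto
  next
    case (insert H B)
    then obtain u where u: "u \<in> D" "\<forall>K\<in>B. \<not> D \<subseteq> K \<longrightarrow> Im (lin K u / lin K v) \<noteq> 0" by auto
    show ?case
    proof (cases "D \<subseteq> H")
      case True
      then show ?thesis using u by (intro bexI[of _ u]) auto
    next
      case False
      then obtain y where y: "y \<in> D" "y \<notin> H" by auto
      have H: "H \<in> A" using insert by simp
      have ly: "lin H y \<noteq> 0" using y mem_hyperplane[OF H] by simp
      have lv: "lin H v \<noteq> 0" using v H by (simp add: mem_complement)
      \<comment> \<open>Normalized such that the form of \<open>H\<close> has quotient \<open>\<i>\<close> at \<open>d\<close> and \<open>v\<close>.\<close>
      define d where "d = (\<i> * lin H v / lin H y) *s y"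
      have dD: "d \<in> D" unfolding d_def by (rule flat_smult[OF D y(1)])
      have dH: "Im (lin H d / lin H v) = 1" using ly lv by (simp add: d_def form_scale)
      define a where "a K = Im (lin K u / lin K v)" for K
      define b where "b K = Im (lin K d / lin K v)" for K
      define N where "N = {K \<in> insert H B. \<not> D \<subseteq> K}"
      have fin: "finite (\<Union>K\<in>N. {r. a K + r * b K = 0})"
      proof (rule finite_UN_I)
        show "finite N" unfolding N_def using insert by simp
        fix K assume "K \<in> N"
        then have "a K \<noteq> 0 \<or> b K \<noteq> 0"
          using u(2) dH unfolding N_def a_def b_def by auto
        then show "finite {r. a K + r * b K = 0}" by (rule finite_real_linear_roots)
      qed
      obtain r where r: "r \<notin> (\<Union>K\<in>N. {r. a K + r * b K = 0})"
        using ex_new_if_finite[OF infinite_UNIV_char_0 fin] by (elim exE)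
      let ?u = "u + of_real r *s d"
      have Im_u: "Im (lin K ?u / lin K v) = a K + r * b K" for K
      proof -
        have "lin K ?u / lin K v = lin K u / lin K v + of_real r * (lin K d / lin K v)"
          by (simp add: form_add form_scale add_divide_distrib)
        moreover have "Im (of_real r * z) = r * Im z" for z by simp
        ultimately show ?thesis by (simp only: plus_complex.sel a_def b_def)
      qed
      have "\<forall>K\<in>insert H B. \<not> D \<subseteq> K \<longrightarrow> Im (lin K ?u / lin K v) \<noteq> 0"
        unfolding Im_u using r unfolding N_def by blast
      moreover have "?u \<in> D" by (intro flat_add flat_smult D u dD)
      ultimately show ?thesis by (intro bexI[of _ ?u])
    qed
  qed
  from this[OF finite_A subset_refl] show ?thesis .
qed

text \<open>
  If the quotient of a form at \<open>p\<close> and \<open>v\<close> is not real, then that form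
  does not vanish on the real segment between them.
\<close>
lemma admissible_point_exists:
  assumes v: "v \<in> complement A" and X: "X \<in> flats A"
  shows "\<exists>p. admissible_point A v X p"
proof -
  obtain p where p: "p \<in> X" "\<forall>H\<in>A. \<not> X \<subseteq> H \<longrightarrow> Im (lin H p / lin H v) \<noteq> 0"
    using generic_vector[OF v X] by auto
  have "admissible_point A v X p"
    unfolding admissible_point_def
  proof (intro conjI ballI impI p(1))
    fix H assume H: "H \<in> A"
    show "p \<notin> H" if n: "\<not> X \<subseteq> H"
    proof
      assume "p \<in> H"
      then have "lin H p = 0" using mem_hyperplane[OF H] by simp
      moreover have "Im (lin H p / lin H v) \<noteq> 0" using p(2) H n by blast
      ultimately show False by simp
    qed
    assume "closed_segment v p \<inter> H \<noteq> {}"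
    then obtain t where t: "0 \<le> t" "(1 - t) *\<^sub>R v + t *\<^sub>R p \<in> H"
      by (auto simp: in_segment)
    have lv: "lin H v \<noteq> 0" using v H by (simp add: mem_complement)
    define c where "c = lin H p / lin H v"
    have "of_real (1 - t) * lin H v + of_real t * lin H p = 0"
      using t(2) mem_hyperplane[OF H] by (simp only: form_add form_scale scaleR_eq_smult)
    then have eq: "of_real (1 - t) + of_real t * c = 0"
      using lv by (simp add: field_simps c_def)
    have "X \<subseteq> H"
    proof (rule ccontr)
      assume "\<not> X \<subseteq> H"
      then have "Im c \<noteq> 0" using p(2) H unfolding c_def by blast
      have "Im (of_real (1 - t) + of_real t * c) = t * Im c" by simp
      then have "t * Im c = 0" unfolding eq by simp
      with \<open>Im c \<noteq> 0\<close> have "t = 0" by simp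
      then show False using eq by simp
    qed
    then show "H \<in> localization A X" using H by (simp add: localization_def)
  qed
  then show ?thesis ..
qed

lemma compatible_shift_admissible:
  assumes comp: "compatible_shifts S v w" and X: "X \<in> S"
  shows "admissible_point A v X (v - w X)"
proof -
  have pX: "v - w X \<in> X" using comp X by (simp add: compatible_shifts_def)
  have avoid: "v - t *\<^sub>R w X \<notin> H" if H: "H \<in> A" "\<not> X \<subseteq> H" and t: "0 \<le> t" for H t
  proof
    assume "v - t *\<^sub>R w X \<in> H"
    then have z: "lin H v - of_real t * lin H (w X) = 0"
      using mem_hyperplane[OF H(1)] by (simp only: form_diff form_scale scaleR_eq_smult)
    have "\<exists>h. Re (h * lin H v) > 0 \<and> (\<forall>X\<in>S. \<not> X \<subseteq> H \<longrightarrow> Re (h * lin H (w X)) \<le> 0)"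
      using comp H(1) unfolding compatible_shifts_def by (elim conjE) (rule bspec)
    then obtain h where h1: "Re (h * lin H v) > 0"
      and hS: "\<forall>X\<in>S. \<not> X \<subseteq> H \<longrightarrow> Re (h * lin H (w X)) \<le> 0" by (elim exE conjE)
    have h2: "Re (h * lin H (w X)) \<le> 0" using hS X H(2) by blast
    note h = h1 h2
    have "h * lin H v = of_real t * (h * lin H (w X))"
      using z by (simp add: algebra_simps)
    moreover have "Re (of_real t * z) = t * Re z" for z by simp
    ultimately have "Re (h * lin H v) = t * Re (h * lin H (w X))" by (simp only:)
    then show False using h(1) mult_nonneg_nonpos[OF t h(2)] by linarith
  qed
  show ?thesis
    unfolding admissible_point_def
  proof (intro conjI ballI impI pX)
    fix H assume H: "H \<in> A"
    show "v - w X \<notin> H" if "\<not> X \<subseteq> H" using avoid[OF H that, of 1] by simp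
    assume "closed_segment v (v - w X) \<inter> H \<noteq> {}"
    then obtain t where t: "0 \<le> t" "(1 - t) *\<^sub>R v + t *\<^sub>R (v - w X) \<in> H"
      by (auto simp: in_segment)
    moreover have "(1 - t) *\<^sub>R v + t *\<^sub>R (v - w X) = v - t *\<^sub>R w X" by (simp add: algebra_simps)
    ultimately have "X \<subseteq> H" using avoid[OF H, of t] by auto
    then show "H \<in> localization A X" using H by (simp add: localization_def)
  qed
qed

text \<open>
  The shifts required modulo the flats come from the complements above. To each one a large
  multiple of a generic vector \<open>u M\<close> is added for every \<open>M\<close> strictly
  above \<open>X\<close> in the nested set (or the origin), where \<open>u M\<close> lies in all
  elements of \<open>S\<close> that are not above \<open>M\<close>. For a hyperplane
  \<open>H\<close> whose least element of \<open>S\<close> above it is \<open>M\<close>, the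
  vectors \<open>u M'\<close> with \<open>M'\<close> not below \<open>M\<close> are invisible, and
  the multiples grow with the height in the forest. So at \<open>H\<close> all visible shifts
  point nearly in the one direction of \<open>u M\<close>, which is not real relative to
  \<open>v\<close> and hence can be separated from \<open>v\<close> by a line.
\<close>
lemma compatible_shifts_exist:
  assumes G: "building_set A G" and S: "nested G S" and v: "v \<in> complement A"
  shows "\<exists>w. compatible_shifts S v w"
proof -
  let ?N = "insert {0} S"
  let ?D = "\<lambda>M. \<Inter>{Z \<in> S. \<not> Z \<subseteq> M}"
  have finN: "finite ?N" using finite_nested[OF G S] by simp
  have Sf: "X \<in> flats A" if "X \<in> S" for X by (rule nested_flat[OF G S that])
  have Nf: "X \<in> flats A" if "X \<in> ?N" for X
    using that Sf building_flat[OF G] G by (auto simp: building_set_def)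
  have Df: "?D M \<in> flats A" for M by (rule Inter_flat) (use Sf in auto)
  have "\<forall>X\<in>S. \<exists>w. v - w \<in> X \<and> (\<forall>Y\<in>S. \<not> X \<subseteq> Y \<longrightarrow> \<not> Y \<subseteq> X \<longrightarrow> w \<in> Y)"
    by (intro ballI incomparable_complement[OF G S])
  from bchoice[OF this] obtain w0 where
    w0: "\<forall>X\<in>S. v - w0 X \<in> X \<and> (\<forall>Y\<in>S. \<not> X \<subseteq> Y \<longrightarrow> \<not> Y \<subseteq> X \<longrightarrow> w0 X \<in> Y)"
    by (elim exE)
  have "\<forall>M\<in>?N. \<exists>u. u \<in> ?D M \<and> (\<forall>H\<in>A. \<not> ?D M \<subseteq> H \<longrightarrow> Im (lin H u / lin H v) \<noteq> 0)"
  proof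
    fix M
    show "\<exists>u. u \<in> ?D M \<and> (\<forall>H\<in>A. \<not> ?D M \<subseteq> H \<longrightarrow> Im (lin H u / lin H v) \<noteq> 0)"
      using generic_vector[OF v Df[of M]] unfolding Bex_def .
  qed
  from bchoice[OF this] obtain u where
    u: "\<forall>M\<in>?N. u M \<in> ?D M \<and> (\<forall>H\<in>A. \<not> ?D M \<subseteq> H \<longrightarrow> Im (lin H (u M) / lin H v) \<noteq> 0)"
    by (elim exE)
  have uZ: "u M \<in> Z" if "M \<in> ?N" "Z \<in> S" "\<not> Z \<subseteq> M" for M Z
  proof -
    have "u M \<in> ?D M" using bspec[OF u that(1)] by (rule conjunct1)
    then show ?thesis by (rule InterD) (use that in simp)
  qed
  have u_Im: "Im (lin H (u M) / lin H v) \<noteq> 0" if "M \<in> ?N" "H \<in> A" "\<not> ?D M \<subseteq> H" for M H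
    using bspec[OF conjunct2[OF bspec[OF u that(1)]] that(2)] that(3) by (rule mp)
  have w0X: "v - w0 X \<in> X" if "X \<in> S" for X
    using bspec[OF w0 that] by (rule conjunct1)
  have w0Y: "w0 X \<in> Y" if "X \<in> S" "Y \<in> S" "\<not> X \<subseteq> Y" "\<not> Y \<subseteq> X" for X Y
    using that(3,4) by (intro conjunct2[OF bspec[OF w0 that(1)], rule_format, OF that(2)])
  \<comment> \<open>The exponent increases strictly upwards in the lattice, which makes the topmost visible term dominant.\<close>
  define k where "k M = card {Z \<in> ?N. M \<subseteq> Z}" for M
  have k_mono: "k M' < k M" if "M \<in> ?N" "M \<subset> M'" for M M'
    unfolding k_def
  proof (rule psubset_card_mono)
    show "finite {Z \<in> ?N. M \<subseteq> Z}" using finN by simp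
    show "{Z \<in> ?N. M' \<subseteq> Z} \<subset> {Z \<in> ?N. M \<subseteq> Z}"
    proof (rule psubsetI)
      show "{Z \<in> ?N. M' \<subseteq> Z} \<subseteq> {Z \<in> ?N. M \<subseteq> Z}" using that(2) by blast
      have "M \<in> {Z \<in> ?N. M \<subseteq> Z}" "M \<notin> {Z \<in> ?N. M' \<subseteq> Z}" using that by blast+
      then show "{Z \<in> ?N. M' \<subseteq> Z} \<noteq> {Z \<in> ?N. M \<subseteq> Z}" by metis
    qed
  qed
  have k_pos: "0 < k M" if "M \<in> ?N" for M
  proof -
    have "finite {Z \<in> ?N. M \<subseteq> Z}" "M \<in> {Z \<in> ?N. M \<subseteq> Z}" using finN that by simp_all
    then show ?thesis unfolding k_def card_gt_0_iff by blast
  qed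
  define w where "w R X = w0 X + (\<Sum>M\<in>{M \<in> ?N. M \<subset> X}. of_real (R ^ k M) *s u M)" for R X
  have lin_w: "lin H (w R X) = lin H (w0 X) + (\<Sum>M\<in>{M \<in> ?N. M \<subset> X}. of_real (R ^ k M) * lin H (u M))"
    for H R X by (simp only: w_def form_add form_sum form_scale)
  have w1: "v - w R X \<in> X" if X: "X \<in> S" for R X
  proof -
    have "(\<Sum>M\<in>{M \<in> ?N. M \<subset> X}. of_real (R ^ k M) *s u M) \<in> X"
      using X by (intro flat_sum[OF Sf[OF X]] flat_smult[OF Sf[OF X]] uZ) auto
    then have "(v - w0 X) - (\<Sum>M\<in>{M \<in> ?N. M \<subset> X}. of_real (R ^ k M) *s u M) \<in> X"
      by (rule flat_diff[OF Sf[OF X] w0X[OF X]])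
    then show ?thesis by (simp only: w_def diff_diff_eq)
  qed
  have w2: "w R X \<in> Y" if X: "X \<in> S" and Y: "Y \<in> S" "\<not> X \<subseteq> Y" "\<not> Y \<subseteq> X" for R X Y
    unfolding w_def
  proof (intro flat_add[OF Sf[OF Y(1)]] w0Y[OF X Y] flat_sum[OF Sf[OF Y(1)]] flat_smult[OF Sf[OF Y(1)]])
    fix M assume "M \<in> {M \<in> ?N. M \<subset> X}"
    then show "u M \<in> Y" using Y by (intro uZ) auto
  qed
  have "\<forall>H\<in>A. \<exists>h. Re (h * lin H v) > 0 \<and>
      (\<forall>X\<in>S. \<not> X \<subseteq> H \<longrightarrow> (\<forall>\<^sub>F R in at_top. Re (h * lin H (w R X)) \<le> 0))"
  proof
    fix H assume H: "H \<in> A"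
    obtain M where M: "least_above S H M" by (rule least_above_exists[OF G S H])
    then have MN: "M \<in> ?N" and MH: "M \<subseteq> H" by (simp_all add: least_above_def)
    have lv: "lin H v \<noteq> 0" using v H by (simp add: mem_complement)
    have "Im (lin H (u M) / lin H v) \<noteq> 0"
      by (rule u_Im[OF MN H not_above_avoids_hyperplane[OF G S H M]])
    then obtain h where h: "Re (h * lin H v) > 0" "Re (h * lin H (u M)) < 0"
      by (rule separating_multiplier[OF lv])
    have vanish: "lin H (u M') = 0" if M': "M' \<in> ?N" "\<not> M \<subseteq> M'" for M'
    proof -
      have "M \<noteq> {0}" using M'(2) flat_zero[OF Nf[OF M'(1)]] by auto
      then have "M \<in> S" using MN by simp
      then have "u M' \<in> H" using uZ[OF M'(1) _ M'(2)] MH by auto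
      then show ?thesis using mem_hyperplane[OF H] by simp
    qed
    have "\<forall>\<^sub>F R in at_top. Re (h * lin H (w R X)) \<le> 0" if X: "X \<in> S" "\<not> X \<subseteq> H" for X
    proof -
      let ?I = "{M \<in> ?N. M \<subset> X}"
      have Re_w: "Re (h * lin H (w R X)) =
          Re (h * lin H (w0 X)) + (\<Sum>M\<in>?I. R ^ k M * Re (h * lin H (u M)))" for R
      proof -
        have "h * lin H (w R X) = h * lin H (w0 X) + (\<Sum>M\<in>?I. of_real (R ^ k M) * (h * lin H (u M)))"
          unfolding lin_w distrib_left sum_distrib_left by (simp only: mult.left_commute)
        moreover have "Re (of_real r * z) = r * Re z" for r z by simp
        ultimately show ?thesis by (simp only: plus_complex.sel Re_sum)
      qed
      show ?thesis
      proof (cases "M \<subset> X")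
        case True
        show ?thesis
          unfolding Re_w
        proof (rule dominant_power_eventually_nonpos[where j = M])
          show "Re (h * lin H (u M')) = 0 \<or> k M' < k M" if "M' \<in> ?I" "M' \<noteq> M" for M'
          proof (cases "M \<subseteq> M'")
            case True
            then show ?thesis using k_mono[OF MN, of M'] that by auto
          next
            case False
            then show ?thesis using vanish[of M'] that by simp
          qed
        qed (use finN MN True h(2) k_pos in auto)
      next
        case False
        then have inc: "\<not> M \<subseteq> X" using MH X(2) by auto
        have "\<not> X \<subseteq> M" using MH X(2) by auto
        moreover have "M \<noteq> {0}" using inc flat_zero[OF Sf[OF X(1)]] by auto
        then have "M \<in> S" using MN by simp
        ultimately have "w0 X \<in> M" using w0Y[OF X(1)] inc by simp
        then have "lin H (w0 X) = 0" using MH mem_hyperplane[OF H] by auto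
        moreover have "lin H (u M') = 0" if "M' \<in> ?I" for M'
          using that inc by (intro vanish) auto
        ultimately have "Re (h * lin H (w R X)) = 0" for R
          unfolding Re_w by simp
        then show ?thesis by simp
      qed
    qed
    then show "\<exists>h. Re (h * lin H v) > 0 \<and>
      (\<forall>X\<in>S. \<not> X \<subseteq> H \<longrightarrow> (\<forall>\<^sub>F R in at_top. Re (h * lin H (w R X)) \<le> 0))"
      using h(1) by (intro exI[of _ h]) auto
  qed
  from bchoice[OF this] obtain h where
    h: "\<forall>H\<in>A. Re (h H * lin H v) > 0 \<and>
      (\<forall>X\<in>S. \<not> X \<subseteq> H \<longrightarrow> (\<forall>\<^sub>F R in at_top. Re (h H * lin H (w R X)) \<le> 0))"
    by (elim exE)
  have "\<forall>\<^sub>F R in at_top. \<forall>H\<in>A. \<forall>X\<in>S. \<not> X \<subseteq> H \<longrightarrow> Re (h H * lin H (w R X)) \<le> 0"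
  proof (intro eventually_ball_finite ballI finite_A finite_nested[OF G S])
    fix H X assume "H \<in> A" "X \<in> S"
    then show "\<forall>\<^sub>F R in at_top. \<not> X \<subseteq> H \<longrightarrow> Re (h H * lin H (w R X)) \<le> 0"
      using h by (cases "X \<subseteq> H") simp_all
  qed
  from eventually_happens'[OF trivial_limit_at_top_linorder this]
  obtain R where R: "\<forall>H\<in>A. \<forall>X\<in>S. \<not> X \<subseteq> H \<longrightarrow> Re (h H * lin H (w R X)) \<le> 0"
    by (elim exE)
  have "compatible_shifts S v (w R)"
    unfolding compatible_shifts_def
  proof (intro conjI ballI impI)
    fix H assume H: "H \<in> A"
    show "\<exists>h. Re (h * lin H v) > 0 \<and> (\<forall>X\<in>S. \<not> X \<subseteq> H \<longrightarrow> Re (h * lin H (w R X)) \<le> 0)"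
      using conjunct1[OF bspec[OF h H]] bspec[OF R H] by (intro exI[of _ "h H"] conjI)
  qed (rule w1 w2; assumption)+
  then show ?thesis by (intro exI[of _ "w R"])
qed

end

section \<open>Free abelian subgroups\<close>

lemma (in group) subgroup_commuting_with:
  assumes y: "y \<in> carrier G"
  shows "subgroup {x \<in> carrier G. x \<otimes> y = y \<otimes> x} G"
proof (rule subgroupI)
  fix a assume "a \<in> {x \<in> carrier G. x \<otimes> y = y \<otimes> x}"
  then have a: "a \<in> carrier G" "a \<otimes> y = y \<otimes> a" by auto
  have "inv a \<otimes> y = inv a \<otimes> (y \<otimes> a) \<otimes> inv a"
    using a(1) y by (simp add: m_assoc)
  also have "\<dots> = inv a \<otimes> (a \<otimes> y) \<otimes> inv a" by (simp only: a(2))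
  also have "\<dots> = y \<otimes> inv a" using a(1) y by (simp add: m_assoc[symmetric])
  finally show "inv a \<in> {x \<in> carrier G. x \<otimes> y = y \<otimes> x}" using a by simp
  fix b assume "b \<in> {x \<in> carrier G. x \<otimes> y = y \<otimes> x}"
  then have b: "b \<in> carrier G" "b \<otimes> y = y \<otimes> b" by auto
  have "a \<otimes> b \<otimes> y = a \<otimes> (b \<otimes> y)" using a(1) b(1) y by (simp add: m_assoc)
  also have "\<dots> = a \<otimes> y \<otimes> b" using a(1) b(1) y by (simp add: b(2) m_assoc)
  also have "\<dots> = y \<otimes> (a \<otimes> b)" using a(1) b(1) y by (simp add: a(2) m_assoc)
  finally show "a \<otimes> b \<in> {x \<in> carrier G. x \<otimes> y = y \<otimes> x}" using a b by simp
qed (use y in auto)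

text \<open>
  The elements commuting with a given one form a subgroup; apply this first to generators and then
  to all elements.
\<close>
lemma (in group) comm_group_generate:
  assumes K: "K \<subseteq> carrier G" and comm: "\<And>x y. x \<in> K \<Longrightarrow> y \<in> K \<Longrightarrow> x \<otimes> y = y \<otimes> x"
  shows "comm_group (G\<lparr>carrier := generate G K\<rparr>)"
proof -
  have sub: "subgroup (generate G K) G" by (rule generate_is_subgroup[OF K])
  have Kc: "y \<in> carrier G" if "y \<in> K" for y using K that by auto
  have gc: "x \<in> carrier G" if "x \<in> generate G K" for x using subgroup.mem_carrier[OF sub that] .
  have 1: "x \<otimes> y = y \<otimes> x" if "x \<in> generate G K" "y \<in> K" for x y
  proof -
    have "generate G K \<subseteq> {x \<in> carrier G. x \<otimes> y = y \<otimes> x}"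
      by (rule generate_subgroup_incl[OF _ subgroup_commuting_with[OF Kc[OF that(2)]]])
         (use Kc comm that(2) in auto)
    then show ?thesis using that(1) by blast
  qed
  have 2: "x \<otimes> y = y \<otimes> x" if "x \<in> generate G K" "y \<in> generate G K" for x y
  proof -
    have "generate G K \<subseteq> {y \<in> carrier G. y \<otimes> x = x \<otimes> y}"
      by (rule generate_subgroup_incl[OF _ subgroup_commuting_with[OF gc[OF that(1)]]])
         (use Kc 1[OF that(1)] in auto)
    then have "y \<otimes> x = x \<otimes> y" using that(2) by blast
    then show ?thesis by (rule sym)
  qed
  show ?thesis
    by (rule group.group_comm_groupI[OF subgroup.subgroup_is_group[OF sub group_axioms]])
       (simp add: 2)
qed

text \<open>
  The universal property gives a map of the free abelian group onto the generated subgroup.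
  Additive functions on the group that separate integer combinations of the generators also make
  it injective.
\<close>
lemma free_abelian_subgroup_generate:
  fixes G :: "'a monoid" (structure) and x :: "'s \<Rightarrow> 'a" and W :: "('a \<Rightarrow> complex) set"
  assumes "group G" and S: "finite S" and x: "\<And>s. s \<in> S \<Longrightarrow> x s \<in> carrier G"
    and comm: "\<And>s t. s \<in> S \<Longrightarrow> t \<in> S \<Longrightarrow> x s \<otimes> x t = x t \<otimes> x s"
    and W: "\<And>f a b. f \<in> W \<Longrightarrow> a \<in> carrier G \<Longrightarrow> b \<in> carrier G \<Longrightarrow> f (a \<otimes> b) = f a + f b"
    and indep: "\<And>c :: 's \<Rightarrow> int. (\<And>f. f \<in> W \<Longrightarrow> (\<Sum>s\<in>S. of_int (c s) * f (x s)) = 0) \<Longrightarrow>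
      (\<forall>s\<in>S. c s = 0)"
  shows "free_abelian_subgroup (generate G (x ` S)) G (card S)"
proof -
  interpret group G by fact
  let ?C = "generate G (x ` S)" and ?Z = "free_Abelian_group {..<card S}"
  let ?H = "G\<lparr>carrier := ?C\<rparr>"
  have xS: "x ` S \<subseteq> carrier G" using x by auto
  have sub: "subgroup ?C G" by (rule generate_is_subgroup[OF xS])
  have gH: "group ?H" by (rule subgroup.subgroup_is_group[OF sub group_axioms])
  interpret H: comm_group ?H
    by (rule comm_group_generate[OF xS]) (use comm in auto)
  obtain e where e: "bij_betw e {0..<card S} S" using ex_bij_betw_nat_finite[OF S] by auto
  have e: "bij_betw e {..<card S} S" using e by (simp add: atLeast0LessThan)
  have eS: "e i \<in> S" if "i < card S" for i using e that by (auto simp: bij_betw_def)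
  have "(\<lambda>i. x (e i)) ` {..<card S} \<subseteq> carrier ?H"
    using eS by (auto intro: generate.incl)
  then obtain h where h: "h \<in> hom ?Z ?H" and hx: "\<And>i. i \<in> {..<card S} \<Longrightarrow> h (frag_of i) = x (e i)"
    by (rule H.free_Abelian_group_universal) blast
  interpret h: group_hom ?Z ?H h
    by (rule group_hom.intro[OF group_free_Abelian_group gH]) (unfold_locales, rule h)
  have hC: "h c \<in> carrier G" if "Poly_Mapping.keys c \<subseteq> {..<card S}" for c
    using h.hom_closed[of c] that subgroup.subset[OF sub] by auto
  have eval_h: "f (h c) = (\<Sum>i<card S. of_int (Poly_Mapping.lookup c i) * f (x (e i)))"
    if f: "f \<in> W" and c: "Poly_Mapping.keys c \<subseteq> {..<card S}" for f c
  proof (rule free_Abelian_group_induct[OF c])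
    have "f \<one> = f \<one> + f \<one>" using W[OF f, of \<one> \<one>] by simp
    then have "f \<one> = 0" by simp
    moreover have "h 0 = \<one>" using h.hom_one by simp
    ultimately show "f (h 0) = (\<Sum>i<card S. of_int (Poly_Mapping.lookup 0 i) * f (x (e i)))"
      by simp
  next
    fix a b
    assume a: "Poly_Mapping.keys a \<subseteq> {..<card S}" and b: "Poly_Mapping.keys b \<subseteq> {..<card S}"
      and IHa: "f (h a) = (\<Sum>i<card S. of_int (Poly_Mapping.lookup a i) * f (x (e i)))"
      and IHb: "f (h b) = (\<Sum>i<card S. of_int (Poly_Mapping.lookup b i) * f (x (e i)))"
    have ab: "Poly_Mapping.keys (a - b) \<subseteq> {..<card S}"
      using keys_diff[of a b] a b by blast
    have "h (a - b + b) = h (a - b) \<otimes> h b"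
      using h.hom_mult[of "a - b" b] ab b by (simp del: diff_add_cancel)
    then have "f (h a) = f (h (a - b)) + f (h b)"
      using W[OF f hC[OF ab] hC[OF b]] by simp
    then have "f (h (a - b)) = f (h a) - f (h b)" by simp
    then show "f (h (a - b)) = (\<Sum>i<card S. of_int (Poly_Mapping.lookup (a - b) i) * f (x (e i)))"
      unfolding IHa IHb by (simp add: lookup_minus sum_subtractf left_diff_distrib)
  next
    fix a assume a: "a \<in> {..<card S}"
    have "(\<Sum>i<card S. of_int (Poly_Mapping.lookup (frag_of a) i) * f (x (e i))) =
        (\<Sum>i<card S. if i = a then f (x (e i)) else 0)"
      by (intro sum.cong refl) (simp add: lookup_single when_def)
    also have "\<dots> = f (x (e a))" using a by simp
    finally show "f (h (frag_of a)) =
        (\<Sum>i<card S. of_int (Poly_Mapping.lookup (frag_of a) i) * f (x (e i)))"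
      using hx[OF a] by simp
  qed
  have inj: "inj_on h (carrier ?Z)"
    unfolding h.inj_on_one_iff
  proof (intro allI impI)
    fix c assume "c \<in> carrier ?Z" and one: "h c = \<one>\<^bsub>?H\<^esub>"
    then have c: "Poly_Mapping.keys c \<subseteq> {..<card S}" by simp
    define c' where "c' s = Poly_Mapping.lookup c (inv_into {..<card S} e s)" for s
    have "\<forall>s\<in>S. c' s = 0"
    proof (rule indep)
      fix f assume f: "f \<in> W"
      have "f \<one> = f \<one> + f \<one>" using W[OF f, of \<one> \<one>] by simp
      then have "f \<one> = 0" by simp
      have "(\<Sum>s\<in>S. of_int (c' s) * f (x s)) = (\<Sum>i<card S. of_int (c' (e i)) * f (x (e i)))"
        by (rule sum.reindex_bij_betw[OF e, symmetric])
      also have "\<dots> = (\<Sum>i<card S. of_int (Poly_Mapping.lookup c i) * f (x (e i)))"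
        using e by (intro sum.cong refl) (simp add: c'_def bij_betw_def inv_into_f_f)
      also have "\<dots> = f (h c)" by (rule eval_h[OF f c, symmetric])
      also have "\<dots> = 0" using one \<open>f \<one> = 0\<close> by simp
      finally show "(\<Sum>s\<in>S. of_int (c' s) * f (x s)) = 0" .
    qed
    then have "Poly_Mapping.lookup c i = 0" if "i < card S" for i
      using eS[OF that] that e by (auto simp: c'_def bij_betw_def inv_into_f_f dest!: bspec[of S _ "e i"])
    moreover have "Poly_Mapping.lookup c i = 0" if "\<not> i < card S" for i
      using c that by (auto simp: in_keys_iff)
    ultimately have "c = 0" by (intro poly_mapping_eqI) (metis lookup_zero)
    then show "c = \<one>\<^bsub>?Z\<^esub>" by simp
  qed
  have "subgroup (h ` carrier ?Z) ?H" by (rule h.img_is_subgroup)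
  then have "subgroup (h ` carrier ?Z) G" by (rule incl_subgroup[OF sub])
  moreover have "x ` S \<subseteq> h ` carrier ?Z"
  proof
    fix y assume "y \<in> x ` S"
    then have "y \<in> x ` e ` {..<card S}" by (simp only: bij_betw_imp_surj_on[OF e])
    then obtain i where i: "i < card S" "y = x (e i)" by (elim imageE) simp
    then have "y = h (frag_of i)" "frag_of i \<in> carrier ?Z" using hx[of i] by simp_all
    then show "y \<in> h ` carrier ?Z" by (rule image_eqI)
  qed
  ultimately have "?C \<subseteq> h ` carrier ?Z" by (intro generate_subgroup_incl)
  moreover have "h ` carrier ?Z \<subseteq> ?C" using h.hom_closed by auto
  ultimately have "bij_betw h (carrier ?Z) (carrier ?H)" using inj by (auto simp: bij_betw_def)
  then have "h \<in> iso ?Z ?H" using h by (simp add: iso_def)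
  then have "?Z \<cong> ?H" by (auto simp: is_iso_def)
  then have "?H \<cong> ?Z" by (rule group.iso_sym[OF group_free_Abelian_group])
  then show ?thesis using sub by (simp add: free_abelian_subgroup_def)
qed

context central_arrangement
begin

lemma continuous_map_hopf: "continuous_map (complement_top A) (proj_complement_top A) hopf"
  by (rule quotient_imp_continuous_map[OF quotient_map_hopf])

text \<open>
  The radius of the tube only bounds the radii of the keyhole, so the class does not depend on it.
\<close>
lemma gamma_bar_eq_keyhole:
  assumes v: "v \<in> complement A" and X: "v - w \<in> X" and e: "admissible_radius A v X (v - w) e"
  shows "\<forall>\<^sub>F d in at_right 0. loopin (complement_top A) v (keyhole_loop d v w) \<and>
    gamma_bar A v X (v - w) e = loop_class (proj_complement_top A) (hopf v) (hopf \<circ> keyhole_loop d v w)"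
proof -
  have e0: "e > 0" using e by (simp add: admissible_radius_def)
  have "((\<lambda>d::real. d * norm w) \<longlongrightarrow> 0 * norm w) (at_right 0)" by (intro tendsto_intros)
  then have "\<forall>\<^sub>F d in at_right 0. d * norm w < e" by (rule order_tendstoD(2)) (use e0 in simp)
  moreover have "\<forall>\<^sub>F d in at_right 0. d \<in> {0<..<1::real}" by (rule eventually_at_right_real) simp
  ultimately show ?thesis
  proof eventually_elim
    case (elim d)
    then have d: "0 < d" "d \<le> 1" "d * norm (v - (v - w)) \<le> e" by auto
    have g: "gamma A v X (v - w) e = loop_class (complement_top A) v (keyhole_loop d v w)"
      "loopin (complement_top A) v (keyhole_loop d v w)"
      using gamma_eq_keyhole[OF v X e d] by simp_all
    then show ?case
      unfolding gamma_bar_def g(1)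
      by (simp only: induced_map_loop_class[OF g(2) continuous_map_hopf refl] simp_thms)
  qed
qed

text \<open>
  Triangularity: for the hyperplane owned by \<open>X\<close>, the sum runs only over elements of
  \<open>S\<close> contained in \<open>X\<close>, and for the strictly smaller ones the
  coefficient is zero by induction.
\<close>
lemma nested_indicators_independent:
  fixes c :: "(complex^'n) set \<Rightarrow> int"
  assumes G: "building_set A G" and S: "nested G S"
    and zero: "\<And>H. H \<in> A \<Longrightarrow> (\<Sum>X\<in>S. if X \<subseteq> H then c X else 0) = 0"
    and X: "X \<in> S"
  shows "c X = 0"
  using X
proof (induction X rule: measure_induct_rule[where f = "\<lambda>X. card {Z \<in> S. Z \<subseteq> X}"])
  case (less X)
  have fin: "finite S" by (rule finite_nested[OF G S])
  obtain H where H: "H \<in> A" "least_above S H X"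
    by (rule own_hyperplane[OF G S]) (use less in auto)
  have IH: "c Z = 0" if "Z \<in> S" "Z \<subset> X" for Z
  proof (rule less.IH[OF _ that(1)])
    show "card {Y \<in> S. Y \<subseteq> Z} < card {Y \<in> S. Y \<subseteq> X}"
    proof (rule psubset_card_mono)
      show "finite {Y \<in> S. Y \<subseteq> X}" using fin by simp
      have "X \<in> {Y \<in> S. Y \<subseteq> X}" "X \<notin> {Y \<in> S. Y \<subseteq> Z}" using less.prems that by auto
      moreover have "{Y \<in> S. Y \<subseteq> Z} \<subseteq> {Y \<in> S. Y \<subseteq> X}" using that by blast
      ultimately show "{Y \<in> S. Y \<subseteq> Z} \<subset> {Y \<in> S. Y \<subseteq> X}" by blast
    qed
  qed
  have "(\<Sum>Z\<in>S. if Z \<subseteq> H then c Z else 0) = (\<Sum>Z\<in>S. if Z = X then c X else 0)"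
  proof (intro sum.cong refl)
    fix Z assume Z: "Z \<in> S"
    show "(if Z \<subseteq> H then c Z else 0) = (if Z = X then c X else 0)"
    proof (cases "Z = X")
      case True
      then show ?thesis using H(2) by (simp add: least_above_def)
    next
      case False
      have "c Z = 0" if "Z \<subseteq> H"
      proof -
        have "Z \<subseteq> X" using H(2) Z that by (simp add: least_above_def)
        then show ?thesis using IH[OF Z] False by (simp add: psubset_eq)
      qed
      then show ?thesis using False by simp
    qed
  qed
  also have "\<dots> = c X" using fin less.prems by simp
  finally show ?case using zero[OF H(1)] by simp
qed

text \<open>
  Commutation is inherited from the complement. For the independence, \<open>K\<close> is a
  hyperplane below no element of \<open>S\<close>, so the ratios with the form of \<open>K\<close>
  in the denominator have winding number 1 or 0 on the generators according to whether \<open>X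
  \<subseteq> H\<close>.
\<close>
lemma free_abelian_gamma_bar:
  assumes G: "building_set A G" and S: "nested G S" and S0: "{0} \<notin> S"
    and v: "v \<in> complement A" and comp: "compatible_shifts S v w"
    and e: "\<And>X. X \<in> S \<Longrightarrow> admissible_radius A v X (v - w X) (e X)"
  shows "free_abelian_subgroup
    (generate (fundamental_group (proj_complement_top A) (hopf v))
      ((\<lambda>X. gamma_bar A v X (v - w X) (e X)) ` S))
    (fundamental_group (proj_complement_top A) (hopf v)) (card S)"
proof -
  let ?U = "proj_complement_top A"
  let ?P = "fundamental_group ?U (hopf v)"
  let ?x = "\<lambda>X. gamma_bar A v X (v - w X) (e X)"
  let ?k = "\<lambda>d X. keyhole_loop d v (w X)"
  have hv: "hopf v \<in> topspace ?U" using v by (simp add: topspace_proj_complement_top)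
  interpret P: group ?P by (rule group_fundamental_group[OF hv])
  have rep: "\<forall>\<^sub>F d in at_right 0. loopin (complement_top A) v (?k d X) \<and>
      ?x X = loop_class ?U (hopf v) (hopf \<circ> ?k d X)" if "X \<in> S" for X
    using comp that by (intro gamma_bar_eq_keyhole[OF v _ e]) (simp_all add: compatible_shifts_def)
  have hopf_loop: "loopin ?U (hopf v) (hopf \<circ> f)" if "loopin (complement_top A) v f" for f
    using that by (rule loopin_compose[OF _ continuous_map_hopf refl])
  obtain K where K: "K \<in> A" "least_above S K {0}"
    by (rule own_hyperplane[OF G S insertI1])
  have notK: "\<not> X \<subseteq> K" if X: "X \<in> S" for X
  proof
    assume "X \<subseteq> K"
    then have "X \<subseteq> {0}" using K(2) X by (simp add: least_above_def)
    then have "X = {0}" using flat_zero[OF nested_flat[OF G S X]] by auto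
    then show False using S0 X by simp
  qed
  have winding: "class_winding (form_ratio H K) (?x X) = (if X \<subseteq> H then 1 else 0)"
    if X: "X \<in> S" and H: "H \<in> A" for X H
  proof -
    have "\<forall>\<^sub>F d in at_right (0::real). class_winding (form_ratio H K) (?x X) = (if X \<subseteq> H then 1 else 0)"
      using rep[OF X] winding_keyhole_loop[OF comp v X H K(1) notK[OF X]]
    proof eventually_elim
      case (elim d)
      have l: "loopin (complement_top A) v (?k d X)" using elim(1) by (rule conjunct1)
      have x: "?x X = loop_class ?U (hopf v) (hopf \<circ> ?k d X)" using elim(1) by (rule conjunct2)
      show ?case
        unfolding x class_winding_loop_class[OF hopf_loop[OF l] continuous_map_form_ratio[OF H K(1)]]
        by (rule mp[OF elim(2) l])
    qed
    from eventually_happens'[OF trivial_limit_at_right_real this] show ?thesis by (elim exE)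
  qed
  show ?thesis
  proof (rule free_abelian_subgroup_generate[OF P.group_axioms, where W = "(\<lambda>H. class_winding (form_ratio H K)) ` A"])
    show "finite S" by (rule finite_nested[OF G S])
    show "?x X \<in> carrier ?P" if X: "X \<in> S" for X
    proof -
      obtain d where d: "loopin (complement_top A) v (?k d X) \<and>
          ?x X = loop_class ?U (hopf v) (hopf \<circ> ?k d X)"
        using eventually_happens'[OF trivial_limit_at_right_real rep[OF X]] by (elim exE)
      show ?thesis
        unfolding conjunct2[OF d] carrier_fundamental_group
        using hopf_loop[OF conjunct1[OF d]] by (intro CollectI exI[of _ "hopf \<circ> ?k d X"] conjI refl)
    qed
    show "?x X \<otimes>\<^bsub>?P\<^esub> ?x Y = ?x Y \<otimes>\<^bsub>?P\<^esub> ?x X" if X: "X \<in> S" and Y: "Y \<in> S" for X Y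
    proof -
      have "\<forall>\<^sub>F d in at_right (0::real). ?x X \<otimes>\<^bsub>?P\<^esub> ?x Y = ?x Y \<otimes>\<^bsub>?P\<^esub> ?x X"
        using rep[OF X] rep[OF Y] keyhole_loops_commute[OF comp v X Y]
      proof eventually_elim
        case (elim d)
        have lX: "loopin (complement_top A) v (?k d X)" using elim(1) by (rule conjunct1)
        have lY: "loopin (complement_top A) v (?k d Y)" using elim(2) by (rule conjunct1)
        have concat: "hopf \<circ> concat_loops f g = concat_loops (hopf \<circ> f) (hopf \<circ> g)"
          for f g :: "real \<Rightarrow> complex^'n"
          by (rule ext) (simp add: concat_loops_def)
        show ?case
          unfolding conjunct2[OF elim(1)] conjunct2[OF elim(2)]
            mult_fundamental_group[OF hopf_loop[OF lX] hopf_loop[OF lY]]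
            mult_fundamental_group[OF hopf_loop[OF lY] hopf_loop[OF lX]]
            concat[symmetric]
          by (rule loop_class_eqI[OF loop_homotopic_compose[OF elim(3) continuous_map_hopf refl]])
      qed
      from eventually_happens'[OF trivial_limit_at_right_real this] show ?thesis by (elim exE)
    qed
    show "f (a \<otimes>\<^bsub>?P\<^esub> b) = f a + f b"
      if fW: "f \<in> (\<lambda>H. class_winding (form_ratio H K)) ` A"
        and ab: "a \<in> carrier ?P" "b \<in> carrier ?P" for f a b
    proof -
      obtain H where H: "f = class_winding (form_ratio H K)" "H \<in> A" using fW by (rule imageE)
      show ?thesis
        unfolding H(1) by (rule class_winding_mult[OF ab continuous_map_form_ratio[OF H(2) K(1)]])
    qed
    show "\<forall>X\<in>S. c X = 0"
      if c: "\<And>f. f \<in> (\<lambda>H. class_winding (form_ratio H K)) ` A \<Longrightarrow> (\<Sum>X\<in>S. of_int (c X) * f (?x X)) = 0"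
      for c :: "(complex^'n) set \<Rightarrow> int"
    proof
      fix X assume "X \<in> S"
      show "c X = 0"
      proof (rule nested_indicators_independent[OF G S _ \<open>X \<in> S\<close>])
        fix H assume H: "H \<in> A"
        have "of_int (\<Sum>X\<in>S. if X \<subseteq> H then c X else 0) =
            (\<Sum>X\<in>S. of_int (c X) * class_winding (form_ratio H K) (?x X))"
          unfolding of_int_sum by (intro sum.cong refl) (simp add: winding[OF _ H])
        also have "\<dots> = (0::complex)" by (rule c) (use H in blast)
        finally show "(\<Sum>X\<in>S. if X \<subseteq> H then c X else 0) = 0" by (simp only: of_int_eq_0_iff)
      qed
    qed
  qed
qed

text \<open>
  For flats outside the nested set any admissible point will do.
\<close>
lemma compatible_points_exist:
  assumes G: "building_set A G" and S: "S \<in> nested_complex G" and v: "v \<in> complement A"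
  shows "\<exists>p. (\<forall>X \<in> flats A. admissible_point A v X (p X)) \<and>
    (\<forall>e. (\<forall>X \<in> flats A. admissible_radius A v X (p X) (e X)) \<longrightarrow>
      free_abelian_subgroup
        (generate (fundamental_group (proj_complement_top A) (hopf v))
          ((\<lambda>X. gamma_bar A v X (p X) (e X)) ` S))
        (fundamental_group (proj_complement_top A) (hopf v))
        (card S))"
proof -
  have nS: "nested G S" and S0: "{0} \<notin> S" using S by (auto simp: nested_complex_def)
  obtain w where w: "compatible_shifts S v w"
    using compatible_shifts_exist[OF G nS v] by (elim exE)
  define p where "p X = (if X \<in> S then v - w X else SOME p. admissible_point A v X p)" for X
  have pS: "p X = v - w X" if "X \<in> S" for X using that by (simp add: p_def)
  show ?thesis
  proof (intro exI[of _ p] conjI ballI allI impI)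
    fix X assume X: "X \<in> flats A"
    show "admissible_point A v X (p X)"
    proof (cases "X \<in> S")
      case True
      then show ?thesis using compatible_shift_admissible[OF w] by (simp add: pS)
    next
      case False
      then show ?thesis using someI_ex[OF admissible_point_exists[OF v X]] by (simp add: p_def)
    qed
  next
    fix e assume e: "\<forall>X\<in>flats A. admissible_radius A v X (p X) (e X)"
    have eS: "admissible_radius A v X (v - w X) (e X)" if "X \<in> S" for X
      using bspec[OF e nested_flat[OF G nS that]] unfolding pS[OF that] .
    have eq: "(\<lambda>X. gamma_bar A v X (p X) (e X)) ` S = (\<lambda>X. gamma_bar A v X (v - w X) (e X)) ` S"
      by (intro image_cong refl) (simp only: pS)
    show "free_abelian_subgroup
        (generate (fundamental_group (proj_complement_top A) (hopf v))
          ((\<lambda>X. gamma_bar A v X (p X) (e X)) ` S))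
        (fundamental_group (proj_complement_top A) (hopf v)) (card S)"
      unfolding eq by (rule free_abelian_gamma_bar[OF G nS S0 v w eS])
  qed
qed

end

theorem theorem4p6:
  fixes A :: "(complex^'n) set set"
  assumes "arrangement A" and "central A" and "essential A"
  shows "\<forall>\<^sub>F v in at 0 within complement A.
    \<forall>G S. building_set A G \<longrightarrow> S \<in> nested_complex G \<longrightarrow>
      (\<exists>p. (\<forall>X \<in> flats A. admissible_point A v X (p X)) \<and>
        (\<forall>e. (\<forall>X \<in> flats A. admissible_radius A v X (p X) (e X)) \<longrightarrow>
          free_abelian_subgroup
            (generate (fundamental_group (proj_complement_top A) (hopf v))
              ((\<lambda>X. gamma_bar A v X (p X) (e X)) ` S))
            (fundamental_group (proj_complement_top A) (hopf v))
            (card S)))"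
proof -
  obtain nf where "central_arrangement A nf"
    using assms(1,2) by (rule central_arrangement_forms)
  then interpret central_arrangement A nf .
  show ?thesis
    unfolding eventually_at_filter
    by (rule always_eventually) (intro allI impI compatible_points_exist)
qed

end
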